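(* Let $F:\mathbb{R}^m\rightrightarrows\mathbb{R}^m$ be a standard set-valued map with induced set-valued dynamical system $\Phi$, let $M\subset\mathbb{R}^m$ be compact, and let $A$ be an attractor for $\Phi$ with basin of attraction $\mathcal{B}(A)$. Let $(X(t))_{t\ge0}$ be an $\mathbb{R}^m$-valued process with continuous sample paths, adapted to a filtration $(\mathcal{F}_t)_{t\ge 0}$, and suppose there exists a map $\omega:\mathbb{R}_+^3\to\mathbb{R}_+$ such that, for any $\alpha>0$ and $T>0$, $\omega(t,\alpha,T)$ decreases to $0$ as $t\to+\infty$ and, for every $t$, almost surely $$\mathbb{P}\left(\sup_{s\ge t}\inf_{\mathbf{z}\in S_\Phi}\|\mathbf{z}(\cdot)-X(s+\cdot)\|_{[0,T]}\ge\alpha\ \Big|\ \mathcal{F}_t\right)\le\omega(t,\alpha,T).$$ If $Att(X)\cap\mathcal{B}(A)\neq\emptyset$, then $\mathbb{P}(\mathcal{L}(X)\subset A)>0$.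
   Context: A set-valued map $F:\mathbb{R}^m\rightrightarrows\mathbb{R}^m$ is standard if: $F(x)$ is non-empty, compact and convex for every $x$; its graph is closed; there is $c>0$ with $\sup_{z\in F(x)}\|z\|\le c(1+\|x\|)$ for all $x$. A solution of $\dot{\mathbf{x}}\in F(\mathbf{x})$ is an absolutely continuous $\mathbf{x}:\mathbb{R}\to\mathbb{R}^m$ with $\dot{\mathbf{x}}(t)\in F(\mathbf{x}(t))$ for almost every $t$; $S_x$ is the set of solutions with $\mathbf{x}(0)=x$; $S_\Phi=\bigcup_xS_x$; $\Phi_t(x)=\{\mathbf{x}(t):\mathbf{x}\in S_x\}$, and $\Phi_t(U)$, $\Phi_I(x)$ denote the corresponding unions. $\|\cdot\|_{[0,T]}$ is the uniform norm on $[0,T]$. A non-empty compact set $A$ is an attractor for $\Phi$ if it is invariant (for all $x\in A$ there is $\mathbf{x}\in S_x$ with $\mathbf{x}(\mathbb{R})\subset A$) and there is a neighborhood $U$ of $A$ such that for every $\epsilon>0$ there is $t_\epsilon>0$ with $\Phi_t(U)\subset N^\epsilon(A)$ ($\epsilon$-neighborhood) for all $t\ge t_\epsilon$. Its basin is $\mathcal{B}(A)=\{x:\Phi_{[0,+\infty[}(x)\text{ bounded and }\omega_\Phi(x)\subset A\}$, with $\omega_\Phi(x)=\bigcap_{t\ge0}\overline{\Phi_{[t,\infty[}(x)}$. $\mathcal{L}(X)=\bigcap_{t\ge0}\overline{\{X(s):s\ge t\}}$. A point $p\in M$ is attainable if for any $t>0$ and any neighborhood $U$ of $p$, $\mathbb{P}(\exists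 s\ge t:X(s)\in U)>0$; $Att(X)$ is the set of attainable points. *)

theory Defs
  imports "HOL-Probability.Probability"
begin

section \<open>Differential inclusions and the induced set-valued dynamical system\<close>

definition standard_map :: "('a::euclidean_space \<Rightarrow> 'a set) \<Rightarrow> bool" where
  "standard_map F \<longleftrightarrow>
     (\<forall>x. F x \<noteq> {} \<and> compact (F x) \<and> convex (F x)) \<and>
     closed {(x, z). z \<in> F x} \<and>
     (\<exists>c>0. \<forall>x. (SUP z\<in>F x. norm z) \<le> c * (1 + norm x))"

definition abs_continuous_on :: "real set \<Rightarrow> (real \<Rightarrow> 'a::real_normed_vector) \<Rightarrow> bool" where
  "abs_continuous_on S f \<longleftrightarrow>
     (\<forall>\<epsilon>>0. \<exists>\<delta>>0. \<forall>D :: (real \<times> real) set.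
        finite D \<longrightarrow>
        (\<forall>(a, b)\<in>D. a \<le> b \<and> {a..b} \<subseteq> S) \<longrightarrow>
        pairwise (\<lambda>(a, b) (a', b'). {a<..<b} \<inter> {a'<..<b'} = {}) D \<longrightarrow>
        (\<Sum>(a, b)\<in>D. b - a) < \<delta> \<longrightarrow>
        (\<Sum>(a, b)\<in>D. norm (f b - f a)) < \<epsilon>)"

text \<open>As usual for differential inclusions, absolute continuity of a curve defined on the whole
  line means absolute continuity on every compact interval; on the whole line at once it would
  already exclude the solutions of \<open>x' = x\<close>.\<close>

definition is_solution :: "('a::euclidean_space \<Rightarrow> 'a set) \<Rightarrow> (real \<Rightarrow> 'a) \<Rightarrow> bool" where
  "is_solution F x \<longleftrightarrow>
     (\<forall>a b. abs_continuous_on {a..b} x) \<and>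
     (AE t in lborel. \<exists>v\<in>F (x t). (x has_vector_derivative v) (at t))"

definition solutions_from :: "('a::euclidean_space \<Rightarrow> 'a set) \<Rightarrow> 'a \<Rightarrow> (real \<Rightarrow> 'a) set" where
  "solutions_from F x = {z. is_solution F z \<and> z 0 = x}"

definition solutions :: "('a::euclidean_space \<Rightarrow> 'a set) \<Rightarrow> (real \<Rightarrow> 'a) set" where
  "solutions F = (\<Union>x. solutions_from F x)"

definition flow :: "('a::euclidean_space \<Rightarrow> 'a set) \<Rightarrow> real \<Rightarrow> 'a \<Rightarrow> 'a set" where
  "flow F t x = {z t | z. z \<in> solutions_from F x}"

definition omega_limit :: "('a::euclidean_space \<Rightarrow> 'a set) \<Rightarrow> 'a \<Rightarrow> 'a set" where
  "omega_limit F x = (\<Inter>t\<in>{0..}. closure (\<Union>s\<in>{t..}. flow F s x))"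

definition invariant_set :: "('a::euclidean_space \<Rightarrow> 'a set) \<Rightarrow> 'a set \<Rightarrow> bool" where
  "invariant_set F A \<longleftrightarrow> (\<forall>x\<in>A. \<exists>z\<in>solutions_from F x. range z \<subseteq> A)"

definition attractor :: "('a::euclidean_space \<Rightarrow> 'a set) \<Rightarrow> 'a set \<Rightarrow> bool" where
  "attractor F A \<longleftrightarrow>
     A \<noteq> {} \<and> compact A \<and> invariant_set F A \<and>
     (\<exists>U. A \<subseteq> interior U \<and>
        (\<forall>\<epsilon>>0. \<exists>t\<^sub>\<epsilon>>0. \<forall>t\<ge>t\<^sub>\<epsilon>. (\<Union>x\<in>U. flow F t x) \<subseteq> {y. infdist y A < \<epsilon>}))"

definition basin :: "('a::euclidean_space \<Rightarrow> 'a set) \<Rightarrow> 'a set \<Rightarrow> 'a set" where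
  "basin F A = {x. bounded (\<Union>t\<in>{0..}. flow F t x) \<and> omega_limit F x \<subseteq> A}"


section \<open>Continuous-time processes\<close>

text \<open>Time is of type \<^typ>\<open>real\<close>; only the values at times \<open>t \<ge> 0\<close> matter.\<close>

definition nonneg_filtration :: "'w measure \<Rightarrow> (real \<Rightarrow> 'w measure) \<Rightarrow> bool" where
  "nonneg_filtration P Fil \<longleftrightarrow>
     (\<forall>t\<ge>0. subalgebra P (Fil t)) \<and>
     (\<forall>s t. 0 \<le> s \<and> s \<le> t \<longrightarrow> sets (Fil s) \<subseteq> sets (Fil t))"

definition limit_set :: "(real \<Rightarrow> 'a::topological_space) \<Rightarrow> 'a set" where
  "limit_set x = (\<Inter>t\<in>{0..}. closure (x ` {t..}))"

definition attainable ::
    "'w measure \<Rightarrow> 'a::topological_space set \<Rightarrow> (real \<Rightarrow> 'w \<Rightarrow> 'a) \<Rightarrow> 'a set" where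
  "attainable P M X =
     {p\<in>M. \<forall>t>0. \<forall>U. open U \<and> p \<in> U \<longrightarrow> measure P {w\<in>space P. \<exists>s\<ge>t. X s w \<in> U} > 0}"

definition cond_prob_given :: "'w measure \<Rightarrow> 'w measure \<Rightarrow> 'w set \<Rightarrow> 'w \<Rightarrow> real" where
  "cond_prob_given P G E = real_cond_exp P G (indicator E)"

text \<open>Extended real values, so that suprema of unbounded families are \<open>\<infinity>\<close>; on \<^typ>\<open>real\<close> they
  would be unspecified.\<close>

definition unif_norm :: "real \<Rightarrow> (real \<Rightarrow> 'a::real_normed_vector) \<Rightarrow> ereal" where
  "unif_norm T f = (SUP u\<in>{0..T}. ereal (norm (f u)))"

end

theory Submission
  imports Defs "HOL-Complex_Analysis.Great_Picard"
begin

text \<open>Solutions of a standard differential inclusion starting in a bounded set are sequentially compact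
  for pointwise convergence. Hence, for a point \<open>p\<close> of the basin, there is a time at which all solutions
  started near \<open>p\<close> are close to \<open>A\<close>. With positive probability \<open>X\<close> visits the neighbourhood of \<open>p\<close> at
  some late deterministic time \<open>s\<close>, and conditionally on \<open>\<F>\<^sub>s\<close> the path is shadowed by
  solutions from then on with positive probability. Shadowing first brings \<open>X\<close> close to \<open>A\<close> and then, by
  uniform attraction, keeps it there. As the shadowing error almost surely tends to \<open>0\<close>, the limit set
  of such a path lies in \<open>A\<close>.

  That a limit of solutions is a solution requires that Lipschitz curves are almost everywhere
  differentiable, which is obtained from the Vitali covering theorem. Measurability of the shadowing
  events comes from the separability of spaces of continuous functions on \<open>[0, T]\<close>.\<close>

section \<open>Almost everywhere differentiability of Lipschitz curves\<close>

text \<open>Shadowing controls all restart times after \<open>s\<close> at once, so a new solution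
  can be taken at each restart and errors do not accumulate. One pair \<open>(\<alpha>, T)\<close>,
  determined by the radius of attraction and the behaviour near \<open>p\<close>, is therefore
  enough to trap the path for ever. It is fixed before the visiting time \<open>s\<close>, and then
  \<open>om s \<alpha> T < 1\<close> is all it takes for shadowing to hold with positive probability
  on the visit. The convergence of \<open>om\<close> to 0 enters a second time, for every
  \<open>(\<alpha>, T)\<close> along integer times, to make late shadowing almost sure at every
  accuracy. For solutions, the integral representation of an absolutely continuous curve is replaced
  by the inequality \<open>w \<bullet> (z b - z a) \<le> c * (b - a)\<close> for curves whose
  derivative lies almost everywhere in a half-space. It gives the growth and Lipschitz estimates,
  and it is the form that passes to limits of solutions, because a closed convex value of
  \<open>F\<close> is an intersection of half-spaces.\<close>

text \<open>Vitali covering for balls, rephrased for intervals. Disjointness concerns half-open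
  intervals \<open>{u<..v}\<close>, whose Stieltjes measure is an increment of the function, whereas
  the covering is by open ones, so that their union can serve as the open set of a further covering.
  Passing to open intervals loses only countably many end points.\<close>

lemma Vitali_covering_intervals:
  fixes E U :: "real set" and Q :: "real \<Rightarrow> real \<Rightarrow> bool"
  assumes U: "open U" "E \<subseteq> U"
    and fine: "\<And>x d. x \<in> E \<Longrightarrow> d > 0 \<Longrightarrow> \<exists>u v. u < v \<and> u \<le> x \<and> x \<le> v \<and> v - u < d \<and> Q u v"
  obtains C :: "(real \<times> real) set" where
    "countable C"
    "\<And>u v. (u, v) \<in> C \<Longrightarrow> u < v \<and> {u..v} \<subseteq> U \<and> Q u v"
    "disjoint_family_on (\<lambda>(u, v). {u<..v}) C"
    "negligible (E - (\<Union>(u, v)\<in>C. {u<..<v}))"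
proof -
  define K where "K = {(u, v). u < v \<and> {u..v} \<subseteq> U \<and> Q u v}"
  define a :: "real \<times> real \<Rightarrow> real" where "a = (\<lambda>(u, v). (u + v) / 2)"
  define r :: "real \<times> real \<Rightarrow> real" where "r = (\<lambda>(u, v). (v - u) / 2)"
  have cb: "cball (a i) (r i) = {fst i..snd i}" for i
    by (cases i) (auto simp: a_def r_def cball_def dist_real_def abs_if field_simps split: if_splits)
  have r: "0 < r i" if "i \<in> K" for i
    using that by (auto simp: K_def r_def)
  have cover: "\<exists>i. i \<in> K \<and> x \<in> cball (a i) (r i) \<and> r i < d" if x: "x \<in> E" and d: "0 < d" for x d
  proof -
    obtain e where e: "e > 0" "ball x e \<subseteq> U"
      using U x by (meson openE subsetD)
    obtain u v where uv: "u < v" "u \<le> x" "x \<le> v" "v - u < min d e" "Q u v"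
      using fine[OF x, of "min d e"] d e(1) by auto
    have "{u..v} \<subseteq> ball x e"
      using uv by (auto simp: dist_real_def)
    with uv e(2) have "(u, v) \<in> K"
      by (auto simp: K_def)
    moreover have "r (u, v) < d"
      using uv by (simp add: r_def)
    ultimately show ?thesis
      using uv by (intro exI[of _ "(u, v)"]) (auto simp: cb)
  qed
  obtain C where C: "countable C" "C \<subseteq> K"
    "pairwise (\<lambda>i j. disjnt (cball (a i) (r i)) (cball (a j) (r j))) C"
    "negligible (E - (\<Union>i\<in>C. cball (a i) (r i)))"
    using Vitali_covering_theorem_cballs[of K r E a, OF r cover] by blast
  show thesis
  proof
    show "countable C" by fact
    show "u < v \<and> {u..v} \<subseteq> U \<and> Q u v" if "(u, v) \<in> C" for u v
      using that C(2) by (auto simp: K_def)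
    show "disjoint_family_on (\<lambda>(u, v). {u<..v}) C"
      unfolding disjoint_family_on_def
    proof (intro ballI impI)
      fix i j assume "i \<in> C" "j \<in> C" "i \<noteq> j"
      then have "{fst i..snd i} \<inter> {fst j..snd j} = {}"
        using C(3) unfolding pairwise_def disjnt_def cb by blast
      then show "(case i of (u, v) \<Rightarrow> {u<..v}) \<inter> (case j of (u, v) \<Rightarrow> {u<..v}) = {}"
        by (fastforce simp: split_beta disjoint_iff)
    qed
    have "countable (fst ` C \<union> snd ` C)"
      using C(1) by simp
    then have "negligible (fst ` C \<union> snd ` C)"
      by (simp add: negligible_iff_null_sets countable_imp_null_set_lborel null_sets_completionI)
    with C(4) have "negligible ((E - (\<Union>i\<in>C. cball (a i) (r i))) \<union> (fst ` C \<union> snd ` C))"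
      by (rule negligible_Un)
    then show "negligible (E - (\<Union>(u, v)\<in>C. {u<..<v}))"
      by (rule negligible_subset) (force simp: cb split_beta)
  qed
qed

lemma lmeasurable_outer_open:
  assumes S: "S \<in> lmeasurable" and "e > 0"
  obtains U where "open U" "S \<subseteq> U" "U \<in> lmeasurable" "measure lebesgue U < measure lebesgue S + e"
proof -
  obtain U where U: "open U" "S \<subseteq> U" "U - S \<in> lmeasurable" "emeasure lebesgue (U - S) < ennreal e"
    using sets_lebesgue_outer_open[of S e] S \<open>e > 0\<close> by blast
  have eq: "S \<union> (U - S) = U"
    using U(2) by auto
  have "measure lebesgue (S \<union> (U - S)) \<le> measure lebesgue S + measure lebesgue (U - S)"
    using S U(3) by (intro measure_Un_le) auto
  moreover have "measure lebesgue (U - S) < e"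
    using U(3,4) \<open>e > 0\<close> by (simp add: emeasure_eq_measure2[OF U(3)] ennreal_less_iff)
  moreover have "S \<union> (U - S) \<in> lmeasurable"
    using S U(3) by (rule fmeasurable.Un)
  ultimately show thesis
    using that[OF U(1,2)] eq by simp
qed

section \<open>Oscillating difference quotients of a monotone function\<close>

text \<open>Used to turn slope bounds on single intervals into a comparison of Stieltjes and
  Lebesgue measure on their union.\<close>

lemma emeasure_UN_mono_disjoint:
  assumes "countable C" "disjoint_family_on B C"
    and "\<And>i. i \<in> C \<Longrightarrow> B i \<in> sets M" "\<And>i. i \<in> C \<Longrightarrow> B i \<in> sets N"
    and "\<And>i. i \<in> C \<Longrightarrow> emeasure M (B i) \<le> emeasure N (B i)"
  shows "emeasure M (\<Union>i\<in>C. B i) \<le> emeasure N (\<Union>i\<in>C. B i)"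
  using assms by (simp add: emeasure_UN_countable) (auto intro!: nn_integral_mono)

text \<open>Classical argument with two Vitali coverings: intervals of slope below \<open>p\<close>
  inside an open set slightly larger than \<open>E\<close> and, inside these, intervals of slope
  above \<open>q\<close>. Both cover almost all of \<open>E\<close>, and comparing the increments of
  \<open>f\<close> bounds \<open>q\<close> times the measure of \<open>E\<close> by \<open>p\<close>
  times that of the open set. The bounds \<open>a\<close> and \<open>b\<close> keep the measure of
  \<open>E\<close> finite.\<close>

lemma negligible_oscillation:
  fixes f :: "real \<Rightarrow> real"
  assumes cont: "continuous_on UNIV f" and mono: "mono f" and "p < q"
    and E: "E = {x. a < x \<and> x < b \<and> (\<forall>n. (\<exists>h. h \<noteq> 0 \<and> \<bar>h\<bar> < inverse (real (Suc n)) \<and> (f (x + h) - f x) / h < p)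
                             \<and> (\<exists>h. h \<noteq> 0 \<and> \<bar>h\<bar> < inverse (real (Suc n)) \<and> (f (x + h) - f x) / h > q))}"
  shows "negligible E"
proof (cases "p \<le> 0")
  case True
  \<comment> \<open>Difference quotients of a nondecreasing function are nonnegative, so only
    \<open>p > 0\<close> remains, where \<open>p\<close> and \<open>q\<close> can serve as
    densities.\<close>
  have "(f (x + h) - f x) / h \<ge> 0" for x h
    using monoD[OF mono, of x "x + h"] monoD[OF mono, of "x + h" x]
    by (cases "h \<ge> 0") (auto simp: zero_le_divide_iff)
  then have "\<not> (f (x + h) - f x) / h < p" for x h
    using True by (meson not_less order_trans)
  then have "E = {}"
    unfolding E by blast
  then show ?thesis by simp
next
  case False
  then have p: "p > 0" by simp
  \<comment> \<open>For a fixed \<open>h\<close> both conditions are open in \<open>x\<close> by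
    continuity of \<open>f\<close>, so even the uncountable unions over \<open>h\<close> are open
    and \<open>E\<close> is Borel.\<close>
  have "E = {a<..<b} \<inter> (\<Inter>n. (\<Union>h\<in>{h. h \<noteq> 0 \<and> \<bar>h\<bar> < inverse (real (Suc n))}. {x. (f (x + h) - f x) / h < p})
     \<inter> (\<Union>h\<in>{h. h \<noteq> 0 \<and> \<bar>h\<bar> < inverse (real (Suc n))}. {x. (f (x + h) - f x) / h > q}))" (is "_ = _ \<inter> (\<Inter>n. ?G n)")
    unfolding E by auto
  moreover have "?G n \<in> sets borel" for n
    by (intro sets.Int borel_open open_UN ballI open_Collect_less continuous_intros
          continuous_on_compose2[OF cont]) auto
  ultimately have Eb [measurable]: "E \<in> sets borel"
    by simp
  have right: "continuous (at_right x) f" for x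
    using cont by (meson UNIV_I continuous_on_eq_continuous_at continuous_at_imp_continuous_within open_UNIV)
  define \<mu> where "\<mu> = interval_measure f"
  have \<mu>: "emeasure \<mu> {u<..v} = ennreal (f v - f u)" if "u \<le> v" for u v
    unfolding \<mu>_def using that mono right by (intro emeasure_interval_measure_Ioc) (auto simp: mono_def)
  have \<mu>s [simp]: "sets \<mu> = sets borel"
    by (simp add: \<mu>_def)
  have Efin: "emeasure lborel E \<le> ennreal (b - a)"
  proof (cases "a \<le> b")
    case True
    have "emeasure lborel E \<le> emeasure lborel {a<..<b}"
      by (rule emeasure_mono) (auto simp: E)
    then show ?thesis using True by simp
  next
    case False
    then have "E = {}" by (auto simp: E)
    then show ?thesis by simp
  qed
  then have Ele: "E \<in> lmeasurable"
    by (intro fmeasurableI) (auto simp: emeasure_completion le_less_trans ennreal_less_top)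
  \<comment> \<open>The point \<open>x\<close> becomes the left or the right end of the interval,
    according to the sign of the increment.\<close>
  have both: "\<exists>u v. u < v \<and> u \<le> x \<and> x \<le> v \<and> v - u < d \<and> f v - f u < p * (v - u)"
      "\<exists>u v. u < v \<and> u \<le> x \<and> x \<le> v \<and> v - u < d \<and> f v - f u > q * (v - u)"
    if xd: "x \<in> E" "d > 0" for x d
  proof -
    obtain n where n: "inverse (real (Suc n)) < d"
      using reals_Archimedean xd(2) by blast
    from xd(1) n obtain h where h: "h \<noteq> 0" "\<bar>h\<bar> < d" "(f (x + h) - f x) / h < p"
      unfolding E by (auto; smt (verit))
    from xd(1) n obtain k where k: "k \<noteq> 0" "\<bar>k\<bar> < d" "(f (x + k) - f x) / k > q"
      unfolding E by (auto; smt (verit))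
    show "\<exists>u v. u < v \<and> u \<le> x \<and> x \<le> v \<and> v - u < d \<and> f v - f u < p * (v - u)"
    proof (cases "h > 0")
      case True
      then show ?thesis using h by (intro exI[of _ x] exI[of _ "x + h"]) (auto simp: field_simps)
    next
      case False
      then show ?thesis using h by (intro exI[of _ "x + h"] exI[of _ x]) (auto simp: field_simps)
    qed
    show "\<exists>u v. u < v \<and> u \<le> x \<and> x \<le> v \<and> v - u < d \<and> f v - f u > q * (v - u)"
    proof (cases "k > 0")
      case True
      then show ?thesis using k by (intro exI[of _ x] exI[of _ "x + k"]) (auto simp: field_simps)
    next
      case False
      then show ?thesis using k by (intro exI[of _ "x + k"] exI[of _ x]) (auto simp: field_simps)
    qed
  qed
  have key: "q * measure lebesgue E \<le> p * (measure lebesgue E + e)" if e: "e > 0" for e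
  proof -
    obtain U where U: "open U" "E \<subseteq> U" "U \<in> lmeasurable" "measure lebesgue U < measure lebesgue E + e"
      using lmeasurable_outer_open[OF Ele e] by (smt (verit))
    obtain C where C: "countable C" "\<And>u v. (u, v) \<in> C \<Longrightarrow> u < v \<and> {u..v} \<subseteq> U \<and> f v - f u < p * (v - u)"
      "disjoint_family_on (\<lambda>(u, v). {u<..v}) C" "negligible (E - (\<Union>(u, v)\<in>C. {u<..<v}))"
      using Vitali_covering_intervals[OF U(1,2), of "\<lambda>u v. f v - f u < p * (v - u)"] both(1) by auto
    \<comment> \<open>The second covering is sought inside \<open>V\<close>, so that its intervals
      lie in those of the first; the part of \<open>E\<close> outside \<open>V\<close> is
      negligible.\<close>
    define V where "V = (\<Union>(u, v)\<in>C. {u<..<v})"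
    have V: "open V" unfolding V_def by auto
    obtain D where D: "countable D" "\<And>u v. (u, v) \<in> D \<Longrightarrow> u < v \<and> {u..v} \<subseteq> V \<and> f v - f u > q * (v - u)"
      "disjoint_family_on (\<lambda>(u, v). {u<..v}) D" "negligible (E \<inter> V - (\<Union>(u, v)\<in>D. {u<..<v}))"
      using Vitali_covering_intervals[OF V, of "E \<inter> V" "\<lambda>u v. f v - f u > q * (v - u)"] both(2) by auto
    let ?W = "\<Union>i\<in>D. (case i of (u, v) \<Rightarrow> {u<..v})" and ?V = "\<Union>i\<in>C. (case i of (u, v) \<Rightarrow> {u<..v})"
    have mW [measurable]: "?W \<in> sets borel" and mV [measurable]: "?V \<in> sets borel"
      using C(1) D(1) by (auto intro!: sets.countable_UN')
    have WV: "?W \<subseteq> ?V"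
    proof
      fix x assume "x \<in> ?W"
      then obtain u v where "(u, v) \<in> D" "x \<in> {u..v}" by auto
      with D(2) have "x \<in> V" by blast
      then obtain u v where "(u, v) \<in> C" "x \<in> {u<..<v}"
        unfolding V_def by auto
      then show "x \<in> ?V"
        by (intro UN_I[of "(u, v)"]) auto
    qed
    have VU: "?V \<subseteq> U"
    proof
      fix x assume "x \<in> ?V"
      then obtain u v where "(u, v) \<in> C" "x \<in> {u..v}" by auto
      with C(2) show "x \<in> U" by blast
    qed
    have "emeasure lborel E \<le> emeasure lborel (?W \<union> (E - ?W))"
      by (rule emeasure_mono) auto
    also have "\<dots> \<le> emeasure lborel ?W + emeasure lborel (E - ?W)"
      by (rule emeasure_subadditive) auto
    also have "emeasure lborel (E - ?W) = 0"
    proof -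
      have "negligible ((E \<inter> V - (\<Union>(u, v)\<in>D. {u<..<v})) \<union> (E - (\<Union>(u, v)\<in>C. {u<..<v})))"
        using D(4) C(4) by (rule negligible_Un)
      then have "negligible (E - ?W)"
        by (rule negligible_subset) (force simp: V_def split_beta)
      then have "E - ?W \<in> null_sets lebesgue"
        by (simp add: negligible_iff_null_sets)
      then show ?thesis
        by (simp add: null_sets_def emeasure_completion)
    qed
    finally have 1: "emeasure lborel E \<le> emeasure lborel ?W" by simp
    \<comment> \<open>The inner intervals have Stieltjes measure at least \<open>q\<close> times
      their length, the outer ones at most \<open>p\<close> times theirs, and
      \<open>?W \<subseteq> ?V\<close> links the two.\<close>
    have "ennreal q * emeasure lborel E \<le> ennreal q * emeasure lborel ?W"
      using 1 by (rule mult_left_mono) simp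
    also have "\<dots> = emeasure (density lborel (\<lambda>_. ennreal q)) ?W"
      by (simp add: emeasure_density_const)
    also have "\<dots> \<le> emeasure \<mu> ?W"
    proof (rule emeasure_UN_mono_disjoint[OF D(1,3)]; clarsimp)
      fix u v assume "(u, v) \<in> D"
      from D(2)[OF this] show "emeasure (density lborel (\<lambda>_. ennreal q)) {u<..v} \<le> emeasure \<mu> {u<..v}"
        using p \<open>p < q\<close> by (simp add: emeasure_density_const \<mu> ennreal_mult[symmetric] ennreal_leI)
    qed
    also have "\<dots> \<le> emeasure \<mu> ?V"
      using WV by (intro emeasure_mono) auto
    also have "\<dots> \<le> emeasure (density lborel (\<lambda>_. ennreal p)) ?V"
    proof (rule emeasure_UN_mono_disjoint[OF C(1,3)]; clarsimp)
      fix u v assume "(u, v) \<in> C"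
      from C(2)[OF this] show "emeasure \<mu> {u<..v} \<le> emeasure (density lborel (\<lambda>_. ennreal p)) {u<..v}"
        using p by (simp add: emeasure_density_const \<mu> ennreal_mult[symmetric] ennreal_leI)
    qed
    also have "\<dots> = ennreal p * emeasure lborel ?V"
      by (simp add: emeasure_density_const)
    also have "\<dots> \<le> ennreal p * emeasure lborel U"
      using VU U(1) by (intro mult_left_mono emeasure_mono) auto
    finally have "ennreal q * emeasure lebesgue E \<le> ennreal p * emeasure lebesgue U"
      using U(1) by (simp add: emeasure_completion)
    then have "ennreal (q * measure lebesgue E) \<le> ennreal (p * measure lebesgue U)"
      using p \<open>p < q\<close> by (simp add: emeasure_eq_measure2[OF Ele] emeasure_eq_measure2[OF U(3)] ennreal_mult)
    then have "q * measure lebesgue E \<le> p * measure lebesgue U"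
      using p by simp
    also have "\<dots> \<le> p * (measure lebesgue E + e)"
      using p U(4) by (intro mult_left_mono) auto
    finally show ?thesis .
  qed
  have "q * measure lebesgue E \<le> p * measure lebesgue E"
  proof (rule field_le_epsilon)
    fix e :: real assume "e > 0"
    then show "q * measure lebesgue E \<le> p * measure lebesgue E + e"
      using key[of "e / p"] p by (simp add: algebra_simps)
  qed
  then have "(q - p) * measure lebesgue E \<le> 0"
    by (simp add: algebra_simps)
  then have "measure lebesgue E = 0"
    using \<open>p < q\<close> measure_nonneg[of lebesgue E] by (smt (verit) mult_pos_pos)
  then show ?thesis
    using Ele by (simp add: negligible_iff_measure0 negligible_iff_measure)
qed


lemma AE_lborel_not_in_negligible:
  assumes "negligible E"
  shows "AE x in lborel. x \<notin> E"
proof -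
  have "AE x in completion lborel. x \<notin> E"
    using assms by (simp add: negligible_iff_null_sets AE_not_in)
  then show ?thesis
    by (simp add: AE_completion_iff)
qed

section \<open>From monotone functions to locally Lipschitz curves\<close>

text \<open>Adding \<open>L * x\<close> makes the function nondecreasing without affecting
  differentiability. Where the lower and upper derivates of the sum differ, two rationals separate
  them, which puts the point into one of countably many negligible sets; elsewhere they agree, and
  the Lipschitz bound makes the common value finite.\<close>

lemma AE_differentiable_if_lipschitz_real:
  fixes f :: "real \<Rightarrow> real"
  assumes lip: "\<And>x y. \<bar>f x - f y\<bar> \<le> L * \<bar>x - y\<bar>"
  shows "AE x in lborel. \<exists>D. (f has_real_derivative D) (at x)"
proof -
  define g where "g x = f x + L * x" for x
  have L: "L \<ge> 0"
    using lip[of 1 0] by simp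
  have g_mono: "mono g"
  proof (rule monoI)
    fix x y :: real assume "x \<le> y"
    then show "g x \<le> g y"
      using lip[of y x] by (simp add: g_def algebra_simps abs_le_iff)
  qed
  have g_lip: "\<bar>g x - g y\<bar> \<le> 2 * L * \<bar>x - y\<bar>" for x y
  proof -
    have "\<bar>g x - g y\<bar> \<le> \<bar>f x - f y\<bar> + \<bar>L * (x - y)\<bar>"
      unfolding g_def by (simp add: algebra_simps)
    then show ?thesis
      using lip[of x y] L by (simp add: abs_mult)
  qed
  have "(2 * L)-lipschitz_on UNIV g"
    using g_lip L by (intro lipschitz_onI) (auto simp: dist_real_def)
  then have g_cont: "continuous_on UNIV g"
    by (rule lipschitz_on_continuous_on)
  define E where "E p q N = {x. - real N < x \<and> x < real N \<and>
     (\<forall>n. (\<exists>h. h \<noteq> 0 \<and> \<bar>h\<bar> < inverse (real (Suc n)) \<and> (g (x + h) - g x) / h < real_of_rat p)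
        \<and> (\<exists>h. h \<noteq> 0 \<and> \<bar>h\<bar> < inverse (real (Suc n)) \<and> (g (x + h) - g x) / h > real_of_rat q))}"
    for p q :: rat and N :: nat
  have "AE x in lborel. \<forall>p q N. p < q \<longrightarrow> x \<notin> E p q N"
    unfolding AE_all_countable E_def
    by (intro allI impI AE_impI AE_lborel_not_in_negligible negligible_oscillation[OF g_cont g_mono _ refl])
      (simp add: of_rat_less)
  then show ?thesis
  proof (rule eventually_mono)
    fix x assume x: "\<forall>p q N. p < q \<longrightarrow> x \<notin> E p q N"
    define \<phi> where "\<phi> h = ereal ((g (x + h) - g x) / h)" for h
    \<comment> \<open>"Frequently near 0", spelled out for the radii that occur in
      \<open>E p q N\<close>.\<close>
    have freq: "\<exists>h. h \<noteq> 0 \<and> \<bar>h\<bar> < inverse (real (Suc n)) \<and> R (\<phi> h)"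
      if "\<not> (\<forall>\<^sub>F h in at 0. \<not> R (\<phi> h))" for R n
    proof (rule ccontr)
      assume "\<not> ?thesis"
      then have "\<forall>\<^sub>F h in at 0. \<not> R (\<phi> h)"
        unfolding eventually_at by (intro exI[of _ "inverse (real (Suc n))"]) (auto simp: dist_real_def)
      with that show False by simp
    qed
    have eq: "Limsup (at 0) \<phi> = Liminf (at 0) \<phi>"
    proof (rule ccontr)
      assume "Limsup (at 0) \<phi> \<noteq> Liminf (at 0) \<phi>"
      then have "Liminf (at 0) \<phi> < Limsup (at 0) \<phi>"
        using Liminf_le_Limsup[of "at (0::real)" \<phi>] by simp
      then obtain q where q: "Liminf (at 0) \<phi> < ereal (real_of_rat q)" "ereal (real_of_rat q) < Limsup (at 0) \<phi>"
        using ereal_dense3 by blast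
      obtain p where p: "Liminf (at 0) \<phi> < ereal (real_of_rat p)" "ereal (real_of_rat p) < ereal (real_of_rat q)"
        using ereal_dense3[OF q(1)] by blast
      have "\<not> (\<forall>\<^sub>F h in at 0. \<not> \<phi> h < ereal (real_of_rat p))"
        using Liminf_bounded[of "ereal (real_of_rat p)" \<phi> "at 0"] p(1) by (auto simp: not_less)
      note 1 = freq[OF this]
      have "\<not> (\<forall>\<^sub>F h in at 0. \<not> \<phi> h > ereal (real_of_rat q))"
        using Limsup_bounded[of \<phi> "ereal (real_of_rat q)" "at 0"] q(2) by (auto simp: not_less)
      note 2 = freq[OF this]
      obtain N :: nat where "\<bar>x\<bar> < real N"
        using reals_Archimedean2 by blast
      then have "x \<in> E p q N"
        using 1 2 unfolding E_def \<phi>_def by auto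
      moreover have "p < q"
        using p(2) by (simp add: of_rat_less)
      ultimately show False using x by blast
    qed
    have bd: "\<bar>(g (x + h) - g x) / h\<bar> \<le> 2 * L" if "h \<noteq> 0" for h
      using g_lip[of "x + h" x] that by (simp add: abs_divide divide_le_eq)
    have "Limsup (at 0) \<phi> \<le> ereal (2 * L)"
    proof (rule Limsup_bounded)
      show "\<forall>\<^sub>F h in at 0. \<phi> h \<le> ereal (2 * L)"
        using bd unfolding eventually_at \<phi>_def by (intro exI[of _ 1]) (auto simp: abs_le_iff simp del: abs_divide)
    qed
    moreover have "ereal (- (2 * L)) \<le> Liminf (at 0) \<phi>"
    proof (rule Liminf_bounded)
      show "\<forall>\<^sub>F h in at 0. ereal (- (2 * L)) \<le> \<phi> h"
        using bd unfolding eventually_at \<phi>_def by (intro exI[of _ 1]) (auto simp: abs_le_iff simp del: abs_divide; smt (verit))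
    qed
    ultimately obtain D where D: "Liminf (at 0) \<phi> = ereal D"
      using eq by (cases "Liminf (at 0) \<phi>") auto
    have "(\<phi> \<longlongrightarrow> ereal D) (at 0)"
      using tendsto_Liminf[OF _ eq] D by simp
    then have "((\<lambda>h. (g (x + h) - g x) / h) \<longlongrightarrow> D) (at 0)"
      unfolding \<phi>_def by simp
    then have "(g has_real_derivative D) (at x)"
      by (simp add: DERIV_def)
    then have "((\<lambda>x. g x - L * x) has_real_derivative D - L) (at x)"
      by (auto intro!: derivative_eq_intros)
    then show "\<exists>D. (f has_real_derivative D) (at x)"
      unfolding g_def by auto
  qed
qed

lemma AE_differentiable_if_lipschitz:
  fixes f :: "real \<Rightarrow> 'a::euclidean_space"
  assumes lip: "\<And>x y. norm (f x - f y) \<le> L * \<bar>x - y\<bar>"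
  shows "AE x in lborel. \<exists>v. (f has_vector_derivative v) (at x)"
proof -
  have "AE x in lborel. \<forall>b\<in>Basis. \<exists>D. ((\<lambda>x. f x \<bullet> b) has_real_derivative D) (at x)"
  proof (subst AE_ball_countable, intro countable_finite finite_Basis, intro ballI AE_differentiable_if_lipschitz_real)
    fix b :: 'a and x y :: real assume "b \<in> Basis"
    then show "\<bar>f x \<bullet> b - f y \<bullet> b\<bar> \<le> L * \<bar>x - y\<bar>"
      using Basis_le_norm[of b "f x - f y"] lip[of x y] by (simp add: inner_diff_left)
  qed
  then show ?thesis
  proof (rule eventually_mono)
    fix x assume "\<forall>b\<in>Basis. \<exists>D. ((\<lambda>x. f x \<bullet> b) has_real_derivative D) (at x)"
    then obtain D where D: "\<And>b. b \<in> Basis \<Longrightarrow> ((\<lambda>x. f x \<bullet> b) has_real_derivative D b) (at x)"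
      by metis
    have "((\<lambda>x. \<Sum>b\<in>Basis. (f x \<bullet> b) *\<^sub>R b) has_vector_derivative (\<Sum>b\<in>Basis. D b *\<^sub>R b)) (at x)"
    proof (rule has_vector_derivative_sum)
      fix b :: 'a assume "b \<in> Basis"
      from has_vector_derivative_scaleR[OF D[OF this] has_vector_derivative_const]
      show "((\<lambda>x. (f x \<bullet> b) *\<^sub>R b) has_vector_derivative D b *\<^sub>R b) (at x)" by simp
    qed
    then show "\<exists>v. (f has_vector_derivative v) (at x)"
      by (auto simp: euclidean_representation)
  qed
qed

text \<open>Clamping the argument to [-N, N] is 1-Lipschitz and changes nothing near an interior
  point, so each clamped curve falls under the global case.\<close>

lemma AE_differentiable_if_locally_lipschitz:
  fixes f :: "real \<Rightarrow> 'a::euclidean_space"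
  assumes lip: "\<And>N::nat. \<exists>L. \<forall>x\<in>{-real N..real N}. \<forall>y\<in>{-real N..real N}. norm (f x - f y) \<le> L * \<bar>x - y\<bar>"
  shows "AE x in lborel. \<exists>v. (f has_vector_derivative v) (at x)"
proof -
  define c where "c N x = max (- real N) (min (real N) x)" for N x
  have "AE x in lborel. \<exists>v. ((\<lambda>x. f (c N x)) has_vector_derivative v) (at x)" for N
  proof -
    obtain L where L: "\<And>x y. x\<in>{-real N..real N} \<Longrightarrow> y\<in>{-real N..real N} \<Longrightarrow> norm (f x - f y) \<le> L * \<bar>x - y\<bar>"
      using lip by blast
    show ?thesis
    proof (rule AE_differentiable_if_lipschitz[of _ "\<bar>L\<bar>"])
      fix x y
      have "norm (f (c N x) - f (c N y)) \<le> L * \<bar>c N x - c N y\<bar>"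
        by (rule L) (auto simp: c_def)
      also have "\<dots> \<le> \<bar>L\<bar> * \<bar>x - y\<bar>"
        by (rule mult_mono) (auto simp: c_def)
      finally show "norm (f (c N x) - f (c N y)) \<le> \<bar>L\<bar> * \<bar>x - y\<bar>" .
    qed
  qed
  then have "AE x in lborel. \<forall>N. \<exists>v. ((\<lambda>x. f (c N x)) has_vector_derivative v) (at x)"
    by (simp add: AE_all_countable)
  then show ?thesis
  proof (rule eventually_mono)
    fix x assume *: "\<forall>N. \<exists>v. ((\<lambda>x. f (c N x)) has_vector_derivative v) (at x)"
    obtain N :: nat where N: "\<bar>x\<bar> < real N"
      using reals_Archimedean2 by blast
    obtain v where "((\<lambda>x. f (c N x)) has_vector_derivative v) (at x)"
      using * by blast
    then have "(f has_vector_derivative v) (at x)"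
    proof (rule has_vector_derivative_transform_within_open)
      show "open {- real N<..<real N}" by simp
      show "x \<in> {- real N<..<real N}" using N by auto
    qed (auto simp: c_def)
    then show "\<exists>v. (f has_vector_derivative v) (at x)" by blast
  qed
qed

section \<open>Absolutely continuous curves\<close>

lemma abs_continuous_onE:
  assumes "abs_continuous_on S z" "e > 0"
  obtains d where "d > 0" "\<And>D. finite D \<Longrightarrow> (\<forall>(u, v)\<in>D. u \<le> v \<and> {u..v} \<subseteq> S) \<Longrightarrow>
      pairwise (\<lambda>(a, b) (a', b'). {a<..<b} \<inter> {a'<..<b'} = {}) D \<Longrightarrow>
      (\<Sum>(a, b)\<in>D. b - a) < d \<Longrightarrow> (\<Sum>(a, b)\<in>D. norm (z b - z a)) < e"
proof -
  from assms(1)[unfolded abs_continuous_on_def, rule_format, OF assms(2)]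
  obtain d where d: "d > 0" and D: "\<forall>D. finite D \<longrightarrow> (\<forall>(u, v)\<in>D. u \<le> v \<and> {u..v} \<subseteq> S) \<longrightarrow>
      pairwise (\<lambda>(a, b) (a', b'). {a<..<b} \<inter> {a'<..<b'} = {}) D \<longrightarrow>
      (\<Sum>(a, b)\<in>D. b - a) < d \<longrightarrow> (\<Sum>(a, b)\<in>D. norm (z b - z a)) < e"
    by (elim exE conjE)
  show thesis
    by (rule that[OF d]) (rule D[THEN spec, THEN mp, THEN mp, THEN mp, THEN mp])
qed

lemma abs_continuous_on_imp_continuous_on:
  assumes "abs_continuous_on {a..b} z"
  shows "continuous_on {a..b} z"
  unfolding continuous_on_iff
proof (intro ballI allI impI)
  fix x and e :: real assume x: "x \<in> {a..b}" and e: "e > 0"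
  obtain d where d: "d > 0" "\<And>D. finite D \<Longrightarrow> (\<forall>(u, v)\<in>D. u \<le> v \<and> {u..v} \<subseteq> {a..b}) \<Longrightarrow>
      pairwise (\<lambda>(a, b) (a', b'). {a<..<b} \<inter> {a'<..<b'} = {}) D \<Longrightarrow>
      (\<Sum>(a, b)\<in>D. b - a) < d \<Longrightarrow> (\<Sum>(a, b)\<in>D. norm (z b - z a)) < e"
    using abs_continuous_onE[OF assms e] by blast
  have "dist (z y) (z x) < e" if y: "y \<in> {a..b}" "dist y x < d" for y
    using d(2)[of "{(min x y, max x y)}"] x y
    by (cases "x \<le> y") (auto simp: dist_norm norm_minus_commute min_def max_def)
  then show "\<exists>d>0. \<forall>x'\<in>{a..b}. dist x' x < d \<longrightarrow> dist (z x') (z x) < e"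
    using d(1) by blast
qed

lemma abs_continuous_on_if_lipschitz:
  assumes "\<And>x y. x \<in> S \<Longrightarrow> y \<in> S \<Longrightarrow> norm (z x - z y) \<le> L * \<bar>x - y\<bar>"
  shows "abs_continuous_on S z"
  unfolding abs_continuous_on_def
proof (intro allI impI)
  fix e :: real assume e: "e > 0"
  show "\<exists>d>0. \<forall>D. finite D \<longrightarrow> (\<forall>(u, v)\<in>D. u \<le> v \<and> {u..v} \<subseteq> S) \<longrightarrow>
      pairwise (\<lambda>(a, b) (a', b'). {a<..<b} \<inter> {a'<..<b'} = {}) D \<longrightarrow>
      (\<Sum>(a, b)\<in>D. b - a) < d \<longrightarrow> (\<Sum>(a, b)\<in>D. norm (z b - z a)) < e"
  proof (intro exI[of _ "e / (\<bar>L\<bar> + 1)"] conjI allI impI)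
    show "e / (\<bar>L\<bar> + 1) > 0" using e by simp
    fix D :: "(real \<times> real) set"
    assume D: "finite D" "\<forall>(u, v)\<in>D. u \<le> v \<and> {u..v} \<subseteq> S" "(\<Sum>(a, b)\<in>D. b - a) < e / (\<bar>L\<bar> + 1)"
    have "(\<Sum>(a, b)\<in>D. norm (z b - z a)) \<le> (\<Sum>(a, b)\<in>D. (\<bar>L\<bar> + 1) * (b - a))"
    proof (rule sum_mono, clarify)
      fix u v assume "(u, v) \<in> D"
      with D(2) have uv: "u \<le> v" "{u..v} \<subseteq> S" by auto
      then have "norm (z v - z u) \<le> L * \<bar>v - u\<bar>"
        by (intro assms) auto
      also have "\<dots> \<le> (\<bar>L\<bar> + 1) * (v - u)"
        using uv by (intro mult_mono) auto
      finally show "norm (z v - z u) \<le> (\<bar>L\<bar> + 1) * (v - u)" .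
    qed
    also have "\<dots> = (\<bar>L\<bar> + 1) * (\<Sum>(a, b)\<in>D. b - a)"
      by (simp add: sum_distrib_left split_def)
    also have "\<dots> < e"
      using D(3) by (simp add: pos_less_divide_eq mult.commute add_nonneg_pos)
    finally show "(\<Sum>(a, b)\<in>D. norm (z b - z a)) < e" .
  qed
qed

section \<open>Mean value inequalities for absolutely continuous curves\<close>

text \<open>The fundamental theorem of calculus as a one-sided estimate, proved with a gauge instead
  of an integral. At a tag with a good derivative the gauge makes the increment of \<open>g\<close>
  over the subinterval at most \<open>c + e1\<close> times its length. Subintervals with other tags
  lie in an open set of small measure, and there absolute continuity bounds the sum of the
  increments.\<close>

lemma inner_increment_le:
  fixes z :: "real \<Rightarrow> 'a::real_inner"
  assumes ac: "abs_continuous_on {a..b} z" and "a \<le> b"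
    and ae: "AE t in lborel. t \<in> {a..b} \<longrightarrow> (\<exists>v. (z has_vector_derivative v) (at t) \<and> w \<bullet> v \<le> c)"
  shows "w \<bullet> (z b - z a) \<le> c * (b - a)"
proof (rule field_le_epsilon)
  fix e :: real assume e: "e > 0"
  define g where "g t = w \<bullet> z t" for t
  \<comment> \<open>The total error consists of three parts of at most \<open>e / 3\<close> each;
    the summands 1 keep the denominators positive.\<close>
  define e1 where "e1 = e / (3 * (b - a + 1))"
  define e2 where "e2 = e / (3 * (norm w + 1))"
  define e3 where "e3 = e / (3 * (\<bar>c\<bar> + 1))"
  have pos: "e1 > 0" "e2 > 0" "e3 > 0"
    using e \<open>a \<le> b\<close> by (auto simp: e1_def e2_def e3_def intro!: divide_pos_pos add_nonneg_pos)
  have "e1 * (b - a) = e / 3 * ((b - a) / (b - a + 1))"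
    by (simp add: e1_def)
  also have "\<dots> \<le> e / 3 * 1"
    using e \<open>a \<le> b\<close> by (intro mult_left_mono) auto
  finally have s1: "e1 * (b - a) \<le> e / 3" by simp
  have "norm w * e2 = e / 3 * (norm w / (norm w + 1))"
    by (simp add: e2_def)
  also have "\<dots> \<le> e / 3 * 1"
    using e by (intro mult_left_mono) (auto simp: divide_le_eq add_nonneg_pos)
  finally have s2: "norm w * e2 \<le> e / 3" by simp
  have "\<bar>c\<bar> * e3 = e / 3 * (\<bar>c\<bar> / (\<bar>c\<bar> + 1))"
    by (simp add: e3_def)
  also have "\<dots> \<le> e / 3 * 1"
    using e by (intro mult_left_mono) auto
  finally have s3: "\<bar>c\<bar> * e3 \<le> e / 3" by simp
  obtain d where d: "d > 0" "\<And>D. finite D \<Longrightarrow> (\<forall>(u, v)\<in>D. u \<le> v \<and> {u..v} \<subseteq> {a..b}) \<Longrightarrow>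
      pairwise (\<lambda>(a, b) (a', b'). {a<..<b} \<inter> {a'<..<b'} = {}) D \<Longrightarrow>
      (\<Sum>(a, b)\<in>D. b - a) < d \<Longrightarrow> (\<Sum>(a, b)\<in>D. norm (z b - z a)) < e2"
    using abs_continuous_onE[OF ac pos(2)] by blast
  obtain N where N: "N \<in> null_sets lborel"
    "{t. \<not> (t \<in> {a..b} \<longrightarrow> (\<exists>v. (z has_vector_derivative v) (at t) \<and> w \<bullet> v \<le> c))} \<subseteq> N"
    using ae unfolding eventually_ae_filter by auto
  have "N \<in> lmeasurable" "measure lebesgue N = 0"
    using N(1) by (auto simp: null_sets_def fmeasurable_def measure_def emeasure_completion)
  \<comment> \<open>The bound \<open>d\<close> makes absolute continuity applicable to the intervals
    inside \<open>U\<close>; \<open>e3\<close> controls their total length when it is multiplied by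
    \<open>\<bar>c\<bar>\<close>.\<close>
  then obtain U where U: "open U" "N \<subseteq> U" "U \<in> lmeasurable" "measure lebesgue U < min d e3"
    using lmeasurable_outer_open[of N "min d e3"] d(1) pos by force
  have good: "\<exists>r>0. \<forall>u v. u \<le> t \<and> t \<le> v \<and> u \<in> ball t r \<and> v \<in> ball t r \<longrightarrow> g v - g u \<le> (c + e1) * (v - u)"
    if t: "t \<in> {a..b}" "t \<notin> N" for t
  proof -
    obtain v where v: "(z has_vector_derivative v) (at t)" "w \<bullet> v \<le> c"
      using N(2) t by blast
    have "(g has_derivative (\<lambda>h. w \<bullet> (h *\<^sub>R v))) (at t)"
      using v(1) unfolding g_def has_vector_derivative_def
      by (auto intro!: derivative_eq_intros)
    then obtain r where r: "r > 0" "\<And>y. norm (y - t) < r \<Longrightarrow> norm (g y - g t - w \<bullet> ((y - t) *\<^sub>R v)) \<le> e1 * norm (y - t)"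
      using pos(1) unfolding has_derivative_at_alt by metis
    have "g y - g x \<le> (c + e1) * (y - x)" if "x \<le> t" "t \<le> y" "x \<in> ball t r" "y \<in> ball t r" for x y
    proof -
      have "\<bar>g y - g t - (y - t) * (w \<bullet> v)\<bar> \<le> e1 * (y - t)"
        using r(2)[of y] that by (simp add: dist_real_def)
      moreover have "\<bar>g x - g t - (x - t) * (w \<bullet> v)\<bar> \<le> e1 * (t - x)"
        using r(2)[of x] that by (simp add: dist_real_def)
      moreover have "(y - x) * (w \<bullet> v) \<le> (y - x) * c"
        using v(2) that by (intro mult_left_mono) auto
      ultimately show ?thesis
        by (simp add: algebra_simps abs_le_iff)
    qed
    then show ?thesis using r(1) by blast
  qed
  then obtain r where r: "\<And>t. t \<in> {a..b} \<Longrightarrow> t \<notin> N \<Longrightarrow> r t > 0"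
    "\<And>t u v. t \<in> {a..b} \<Longrightarrow> t \<notin> N \<Longrightarrow> u \<le> t \<Longrightarrow> t \<le> v \<Longrightarrow> u \<in> ball t (r t) \<Longrightarrow> v \<in> ball t (r t) \<Longrightarrow>
       g v - g u \<le> (c + e1) * (v - u)"
    by metis
  define \<gamma> where "\<gamma> t = (if t \<in> N then U else if t \<in> {a..b} then ball t (r t) else ball t 1)" for t
  have "gauge \<gamma>"
    unfolding gauge_def \<gamma>_def using U r(1) by auto
  then obtain p where p: "p tagged_division_of {a..b}" "\<gamma> fine p"
    using fine_division_exists_real by blast
  have K: "\<exists>u v. K = {u..v} \<and> u \<le> x \<and> x \<le> v \<and> u \<le> v \<and> Inf K = u \<and> Sup K = v \<and> {u..v} \<subseteq> {a..b} \<and> {u..v} \<subseteq> \<gamma> x \<and> x \<in> {a..b}"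
    if xK: "(x, K) \<in> p" for x K
  proof -
    obtain u v where "K = {u..v}"
      using tagged_division_ofD(4)[OF p(1) xK] by auto
    moreover have "x \<in> K" "K \<subseteq> {a..b}"
      using tagged_division_ofD(2,3)[OF p(1) xK] by auto
    moreover have "K \<subseteq> \<gamma> x"
      using p(2) xK by (auto simp: fine_def)
    ultimately show ?thesis
      by (intro exI[of _ u] exI[of _ v]) auto
  qed
  have fin: "finite p"
    using p(1) by (rule tagged_division_of_finite)
  define Bad where "Bad = {(x, K) \<in> p. x \<in> N}"
  have Bad: "Bad \<subseteq> p" "finite Bad"
    using fin by (auto simp: Bad_def intro: finite_subset)
  \<comment> \<open>Increments of \<open>m\<close> add up along the division, are nonnegative, and
    are at least the length of an interval contained in \<open>U\<close>. Hence the bad intervals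
    have total length at most the measure of \<open>U\<close>.\<close>
  define m where "m t = measure lebesgue (U \<inter> {a..t})" for t
  have mU: "U \<inter> {s..t} \<in> lmeasurable" for s t
    using U(3) by (intro fmeasurable_Int_fmeasurable) auto
  have m_mono: "m u \<le> m v" if "u \<le> v" for u v
    unfolding m_def using mU that by (intro measure_mono_fmeasurable) (auto simp: fmeasurableD)
  have m_bad: "v - u \<le> m v - m u" if "u \<le> v" "{u..v} \<subseteq> U" "a \<le> u" for u v
  proof -
    have "measure lebesgue (U \<inter> {a..u}) + measure lebesgue {u<..v} = measure lebesgue (U \<inter> {a..u} \<union> {u<..v})"
      using mU[of a u] that(1) by (intro measure_Union[symmetric]) (auto simp: fmeasurable_def)
    also have "\<dots> \<le> m v"
      unfolding m_def using mU that
      by (intro measure_mono_fmeasurable) (auto simp: fmeasurableD)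
    finally show ?thesis
      using that by (simp add: m_def)
  qed
  \<comment> \<open>Absolute continuity speaks of sets of end point pairs, so the tags are
    dropped.\<close>
  define E where "E = (\<lambda>(x, K). (Inf K, Sup K)) ` Bad"
  have sumBad: "(\<Sum>(x, K)\<in>Bad. Sup K - Inf K) \<le> measure lebesgue U"
  proof -
    have "(\<Sum>(x, K)\<in>Bad. Sup K - Inf K) \<le> (\<Sum>(x, K)\<in>Bad. m (Sup K) - m (Inf K))"
    proof (rule sum_mono, clarify)
      fix x K assume "(x, K) \<in> Bad"
      then have "(x, K) \<in> p" "x \<in> N" by (auto simp: Bad_def)
      then show "Sup K - Inf K \<le> m (Sup K) - m (Inf K)"
        using K[of x K] m_bad by (fastforce simp: \<gamma>_def)
    qed
    also have "\<dots> \<le> (\<Sum>(x, K)\<in>p. m (Sup K) - m (Inf K))"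
    proof (rule sum_mono2[OF fin Bad(1)], clarify)
      fix x K assume "(x, K) \<in> p"
      then show "0 \<le> m (Sup K) - m (Inf K)"
        using K[of x K] m_mono by fastforce
    qed
    also have "\<dots> = m b - m a"
      by (rule additive_tagged_division_1[OF \<open>a \<le> b\<close> p(1)])
    also have "\<dots> \<le> measure lebesgue U"
    proof -
      have "m b \<le> measure lebesgue U"
        unfolding m_def using mU U(3) by (intro measure_mono_fmeasurable) (auto simp: fmeasurableD)
      moreover have "m a \<ge> 0" by (simp add: m_def)
      ultimately show ?thesis by simp
    qed
    finally show ?thesis .
  qed
  have "(\<Sum>(u, v)\<in>E. norm (z v - z u)) < e2"
  proof (rule d(2))
    show "finite E" using Bad by (simp add: E_def)
    show "\<forall>(u, v)\<in>E. u \<le> v \<and> {u..v} \<subseteq> {a..b}"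
      using K Bad(1) unfolding E_def by fastforce
    show "pairwise (\<lambda>(a, b) (a', b'). {a<..<b} \<inter> {a'<..<b'} = {}) E"
    proof (rule pairwiseI)
      fix i j assume ij: "i \<in> E" "j \<in> E" "i \<noteq> j"
      obtain x K1 where 1: "(x, K1) \<in> p" "i = (Inf K1, Sup K1)"
        using ij(1) Bad(1) unfolding E_def by auto
      obtain y K2 where 2: "(y, K2) \<in> p" "j = (Inf K2, Sup K2)"
        using ij(2) Bad(1) unfolding E_def by auto
      obtain u1 v1 where k1: "K1 = {u1..v1}" "Inf K1 = u1" "Sup K1 = v1" using K[OF 1(1)] by blast
      obtain u2 v2 where k2: "K2 = {u2..v2}" "Inf K2 = u2" "Sup K2 = v2" using K[OF 2(1)] by blast
      have "(x, K1) \<noteq> (y, K2)" using 1 2 ij by auto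
      then have "interior K1 \<inter> interior K2 = {}"
        using tagged_division_ofD(5)[OF p(1) 1(1) 2(1)] by auto
      then have "{u1<..<v1} \<inter> {u2<..<v2} = {}"
        by (simp only: k1(1) k2(1) interior_atLeastAtMost_real)
      then show "(case i of (a, b) \<Rightarrow> \<lambda>(a', b'). {a<..<b} \<inter> {a'<..<b'} = {}) j"
        using k1 k2 1(2) 2(2) by simp
    qed
    have "(\<Sum>(u, v)\<in>E. v - u) \<le> (\<Sum>(x, K)\<in>Bad. Sup K - Inf K)"
      unfolding E_def
    proof (rule order_trans[OF sum_image_le])
      show "finite Bad" by fact
      show "0 \<le> (case (case i of (x, K) \<Rightarrow> (Inf K, Sup K)) of (u, v) \<Rightarrow> v - u)" if "i \<in> Bad" for i
        using that K Bad(1) by (cases i) fastforce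
    qed (simp add: o_def split_def)
    also have "\<dots> < d"
      using sumBad U(4) by simp
    finally show "(\<Sum>(u, v)\<in>E. v - u) < d" .
  qed
  \<comment> \<open>Distinct tagged intervals have disjoint interiors, so only degenerate ones can
    coincide after dropping the tags, and their increments are 0.\<close>
  also have "(\<Sum>(u, v)\<in>E. norm (z v - z u)) = (\<Sum>(x, K)\<in>Bad. norm (z (Sup K) - z (Inf K)))"
    unfolding E_def
  proof (subst sum.reindex_nontrivial[OF Bad(2)])
    fix i j assume ij: "i \<in> Bad" "j \<in> Bad" "i \<noteq> j"
      "(case i of (x, K) \<Rightarrow> (Inf K, Sup K)) = (case j of (x, K) \<Rightarrow> (Inf K, Sup K))"
    obtain x K1 y K2 where eq: "i = (x, K1)" "j = (y, K2)" by fastforce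
    have 1: "(x, K1) \<in> p" and 2: "(y, K2) \<in> p" using ij Bad(1) eq by auto
    have "interior K1 \<inter> interior K2 = {}"
      using tagged_division_ofD(5)[OF p(1) 1 2] ij(3) eq by auto
    moreover obtain u1 v1 where k1: "K1 = {u1..v1}" "u1 \<le> v1" "Inf K1 = u1" "Sup K1 = v1" using K[OF 1] by blast
    moreover obtain u2 v2 where "K2 = {u2..v2}" "Inf K2 = u2" "Sup K2 = v2" using K[OF 2] by blast
    ultimately have "interior {u1..v1} = {}"
      using ij(4) eq by auto
    then have "Inf K1 = Sup K1"
      using k1 by simp
    then show "(case case i of (x, K) \<Rightarrow> (Inf K, Sup K) of (u, v) \<Rightarrow> norm (z v - z u)) = 0"
      by (simp add: eq)
  qed (simp add: o_def split_def)
  finally have sum2: "(\<Sum>(x, K)\<in>Bad. norm (z (Sup K) - z (Inf K))) < e2" .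
  have "g b - g a = (\<Sum>(x, K)\<in>p. g (Sup K) - g (Inf K))"
    by (rule additive_tagged_division_1[OF \<open>a \<le> b\<close> p(1), symmetric])
  \<comment> \<open>Every interval is charged \<open>(c + e1)\<close> times its length. At a bad tag
    this charge may be negative, which the term with \<open>\<bar>c\<bar>\<close>
    compensates.\<close>
  also have "\<dots> \<le> (\<Sum>(x, K)\<in>p. (c + e1) * (Sup K - Inf K) +
      (if (x, K) \<in> Bad then norm w * norm (z (Sup K) - z (Inf K)) + \<bar>c\<bar> * (Sup K - Inf K) else 0))"
  proof (rule sum_mono, clarify)
    fix x K assume xK: "(x, K) \<in> p"
    obtain u v where uv: "K = {u..v}" "u \<le> x" "x \<le> v" "u \<le> v" "Inf K = u" "Sup K = v" "{u..v} \<subseteq> \<gamma> x" "x \<in> {a..b}"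
      using K[OF xK] by blast
    show "g (Sup K) - g (Inf K) \<le> (c + e1) * (Sup K - Inf K) +
      (if (x, K) \<in> Bad then norm w * norm (z (Sup K) - z (Inf K)) + \<bar>c\<bar> * (Sup K - Inf K) else 0)"
    proof (cases "x \<in> N")
      case True
      have "g v - g u = w \<bullet> (z v - z u)" by (simp add: g_def inner_diff_right)
      also have "\<dots> \<le> norm w * norm (z v - z u)" by (rule norm_cauchy_schwarz)
      moreover have "0 \<le> (c + e1) * (v - u) + \<bar>c\<bar> * (v - u)"
        unfolding distrib_right[symmetric] using uv pos by (intro mult_nonneg_nonneg) auto
      ultimately show ?thesis
        using True xK uv by (simp add: Bad_def)
    next
      case False
      then have "{u..v} \<subseteq> ball x (r x)"
        using uv by (simp add: \<gamma>_def)
      then have "u \<in> ball x (r x)" "v \<in> ball x (r x)"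
        using uv(4) by (auto simp del: mem_ball)
      then have "g v - g u \<le> (c + e1) * (v - u)"
        using uv False by (intro r(2)[of x]) auto
      then show ?thesis
        using False xK uv by (simp add: Bad_def)
    qed
  qed
  also have "\<dots> = (c + e1) * (b - a) + (\<Sum>(x, K)\<in>Bad. norm w * norm (z (Sup K) - z (Inf K)) + \<bar>c\<bar> * (Sup K - Inf K))"
  proof -
    have "(\<Sum>(x, K)\<in>p. Sup K - Inf K) = b - a"
      by (rule additive_tagged_division_1[OF \<open>a \<le> b\<close> p(1), of "\<lambda>x. x"])
    then have "(\<Sum>(x, K)\<in>p. (c + e1) * (Sup K - Inf K)) = (c + e1) * (b - a)"
      by (simp add: sum_distrib_left[symmetric] split_def)
    moreover have "(\<Sum>i\<in>p. if i \<in> Bad then h i else 0) = (\<Sum>i\<in>Bad. h i)" for h :: "_ \<Rightarrow> real"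
      using Bad fin by (simp add: sum.inter_restrict[symmetric] Int_absorb1)
    ultimately show ?thesis
      by (simp add: sum.distrib split_def)
  qed
  also have "\<dots> = (c + e1) * (b - a) + norm w * (\<Sum>(x, K)\<in>Bad. norm (z (Sup K) - z (Inf K)))
      + \<bar>c\<bar> * (\<Sum>(x, K)\<in>Bad. Sup K - Inf K)"
    by (simp add: sum.distrib sum_distrib_left split_def)
  also have "\<dots> \<le> (c + e1) * (b - a) + norm w * e2 + \<bar>c\<bar> * e3"
    using sum2 sumBad U(4) by (intro add_mono mult_left_mono order_refl) auto
  also have "\<dots> \<le> c * (b - a) + e"
    using s1 s2 s3 by (simp add: algebra_simps)
  finally show "w \<bullet> (z b - z a) \<le> c * (b - a) + e"
    by (simp add: g_def inner_diff_right)
qed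

text \<open>The scalar estimate is tested against the increment itself,
  \<open>w = z b - z a\<close>, and one factor \<open>norm w\<close> is cancelled.\<close>

lemma norm_increment_le:
  fixes z :: "real \<Rightarrow> 'a::real_inner"
  assumes ac: "abs_continuous_on {a..b} z" and "a \<le> b"
    and ae: "AE t in lborel. t \<in> {a..b} \<longrightarrow> (\<exists>v. (z has_vector_derivative v) (at t) \<and> norm v \<le> L)"
  shows "norm (z b - z a) \<le> L * (b - a)"
proof -
  define w where "w = z b - z a"
  have "w \<bullet> (z b - z a) \<le> (norm w * L) * (b - a)"
  proof (rule inner_increment_le[OF ac \<open>a \<le> b\<close>])
    show "AE t in lborel. t \<in> {a..b} \<longrightarrow> (\<exists>v. (z has_vector_derivative v) (at t) \<and> w \<bullet> v \<le> norm w * L)"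
      using ae
    proof (rule eventually_mono)
      fix t assume *: "t \<in> {a..b} \<longrightarrow> (\<exists>v. (z has_vector_derivative v) (at t) \<and> norm v \<le> L)"
      have "w \<bullet> v \<le> norm w * L" if "norm v \<le> L" for v
        using norm_cauchy_schwarz[of w v] mult_left_mono[OF that, of "norm w"] by simp
      with * show "t \<in> {a..b} \<longrightarrow> (\<exists>v. (z has_vector_derivative v) (at t) \<and> w \<bullet> v \<le> norm w * L)"
        by blast
    qed
  qed
  then have "norm w * norm w \<le> norm w * (L * (b - a))"
    by (simp add: w_def power2_norm_eq_inner[symmetric] power2_eq_square mult.assoc)
  \<comment> \<open>When nothing can be cancelled the sign of \<open>L\<close> matters: for
    \<open>a < b\<close>, some point of the interval has a derivative of norm at most
    \<open>L\<close>.\<close>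
  moreover have "0 \<le> L * (b - a)" if "norm w = 0"
  proof (cases "a = b")
    case False
    have "L \<ge> 0"
    proof (rule ccontr)
      assume "\<not> L \<ge> 0"
      then have no: "\<not> norm (v::'a) \<le> L" for v
        using norm_ge_zero[of v] by linarith
      have "AE t in lborel. t \<notin> {a..b}"
        using ae by (rule eventually_mono) (use no in auto)
      then have "{a..b} \<in> null_sets lborel"
        by (simp add: AE_iff_null_sets)
      then show False
        using False \<open>a \<le> b\<close> by (auto simp: null_sets_def ennreal_eq_0_iff)
    qed
    then show ?thesis using \<open>a \<le> b\<close> by simp
  qed simp
  ultimately show ?thesis
    unfolding w_def[symmetric] by (cases "norm w = 0") (simp_all add: mult_le_cancel_left)
qed

section \<open>Compactness of the set of solutions\<close>

lemma is_solutionD: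
  assumes "is_solution F z"
  shows "abs_continuous_on {a..b} z" "continuous_on {a..b} z"
    "AE t in lborel. \<exists>v\<in>F (z t). (z has_vector_derivative v) (at t)"
proof -
  show *: "abs_continuous_on {a..b} z" for a b
    using assms by (simp add: is_solution_def)
  show **: "continuous_on {a..b} z" for a b
    by (rule abs_continuous_on_imp_continuous_on[OF *])
  show "AE t in lborel. \<exists>v\<in>F (z t). (z has_vector_derivative v) (at t)"
    using assms by (simp add: is_solution_def)
qed

text \<open>A real-valued \<open>SUP\<close> bounds the members only of a bounded family;
  compactness of \<open>F x\<close> supplies this.\<close>

lemma standard_map_linear_growth:
  assumes "standard_map F"
  obtains c where "c > 0" "\<And>x v. v \<in> F x \<Longrightarrow> norm v \<le> c * (1 + norm x)"
proof -
  obtain c where c: "c > 0" "\<And>x. (SUP z\<in>F x. norm z) \<le> c * (1 + norm x)"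
    using assms unfolding standard_map_def by blast
  have "norm v \<le> c * (1 + norm x)" if "v \<in> F x" for v x
  proof -
    have "compact (F x)" using assms by (simp add: standard_map_def)
    then have "bounded (F x)" by (rule compact_imp_bounded)
    then have "bdd_above (norm ` F x)"
      unfolding bounded_iff bdd_above_def by auto
    then have "norm v \<le> (SUP z\<in>F x. norm z)"
      by (rule cSUP_upper[OF that])
    with c(2)[of x] show ?thesis by simp
  qed
  with c(1) show thesis by (rule that)
qed

text \<open>Gronwall's estimate in one step: if \<open>m\<close> is the maximal norm on the
  interval, the increment up to the maximum is at most \<open>(1 + m) / 2\<close> by the choice of
  \<open>1 / (2 * c)\<close>, and half of \<open>m\<close> is absorbed on the left.\<close>

lemma solution_doubling:
  assumes c: "c > 0" "\<And>x v. v \<in> F x \<Longrightarrow> norm v \<le> c * (1 + norm x)"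
    and z: "is_solution F z" and st: "\<bar>t - s\<bar> \<le> 1 / (2 * c)"
  shows "norm (z t) \<le> 2 * norm (z s) + 1"
proof -
  define I where "I = {min s t..max s t}"
  have "\<exists>x\<in>I. \<forall>y\<in>I. norm (z y) \<le> norm (z x)"
    unfolding I_def using is_solutionD(2)[OF z]
    by (intro continuous_attains_sup) (auto intro: continuous_intros)
  then obtain x where x: "x \<in> I" "\<And>y. y \<in> I \<Longrightarrow> norm (z y) \<le> norm (z x)"
    by blast
  have bd: "norm (z v - z u) \<le> c * (1 + norm (z x)) * (v - u)" if "u \<le> v" "{u..v} \<subseteq> I" for u v
  proof (rule norm_increment_le[OF is_solutionD(1)[OF z] that(1)])
    show "AE t in lborel. t \<in> {u..v} \<longrightarrow> (\<exists>w. (z has_vector_derivative w) (at t) \<and> norm w \<le> c * (1 + norm (z x)))"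
      using is_solutionD(3)[OF z]
    proof (rule eventually_mono, intro impI)
      fix r assume r: "\<exists>w\<in>F (z r). (z has_vector_derivative w) (at r)" "r \<in> {u..v}"
      then obtain w where w: "w \<in> F (z r)" "(z has_vector_derivative w) (at r)" by blast
      have "norm w \<le> c * (1 + norm (z r))" by (rule c(2)[OF w(1)])
      also have "\<dots> \<le> c * (1 + norm (z x))"
        using x(2)[of r] r(2) that(2) c(1) by (intro mult_left_mono) auto
      finally show "\<exists>w. (z has_vector_derivative w) (at r) \<and> norm w \<le> c * (1 + norm (z x))"
        using w by blast
    qed
  qed
  have "norm (z x - z s) \<le> c * (1 + norm (z x)) * \<bar>x - s\<bar>"
  proof (cases "s \<le> x")
    case True
    then have "{s..x} \<subseteq> I" using x(1) by (auto simp: I_def)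
    then show ?thesis using bd[of s x] True by simp
  next
    case False
    then have "{x..s} \<subseteq> I" using x(1) by (auto simp: I_def)
    then show ?thesis using bd[of x s] False by (simp add: norm_minus_commute)
  qed
  also have "\<dots> \<le> c * (1 + norm (z x)) * (1 / (2 * c))"
    using st x(1) c(1) by (intro mult_left_mono) (auto simp: I_def)
  also have "\<dots> = (1 + norm (z x)) / 2"
    using c(1) by simp
  finally have "norm (z x) \<le> norm (z s) + (1 + norm (z x)) / 2"
    using norm_triangle_ineq2[of "z x" "z s"] by argo
  then have "norm (z x) \<le> 2 * norm (z s) + 1" by argo
  moreover have "norm (z t) \<le> norm (z x)"
    by (rule x(2)) (simp add: I_def)
  ultimately show ?thesis by simp
qed

lemma solutions_bounded:
  assumes F: "standard_map F"
  obtains B where "\<And>z t. is_solution F z \<Longrightarrow> norm (z 0) \<le> R \<Longrightarrow> \<bar>t\<bar> \<le> T \<Longrightarrow> norm (z t) \<le> B"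
proof -
  obtain c where c: "c > 0" "\<And>x v. v \<in> F x \<Longrightarrow> norm v \<le> c * (1 + norm x)"
    using standard_map_linear_growth[OF F] by blast
  define \<tau> where "\<tau> = 1 / (2 * c)"
  have \<tau>: "\<tau> > 0" using c by (simp add: \<tau>_def)
  \<comment> \<open>Adding 1 turns the bound \<open>2 * x + 1\<close> into an exact doubling per
    time step.\<close>
  have *: "norm (z t) + 1 \<le> 2 ^ n * (R + 1)"
    if "is_solution F z" "norm (z 0) \<le> R" "\<bar>t\<bar> \<le> real n * \<tau>" for z n t
    using that(3)
  proof (induction n arbitrary: t)
    case 0
    then show ?case using that by simp
  next
    case (Suc n)
    \<comment> \<open>Scaling \<open>t\<close> towards 0 treats both signs at once: \<open>s\<close>
      lies within \<open>n\<close> steps of 0 and \<open>t\<close> within one step of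
      \<open>s\<close>.\<close>
    define s where "s = t * (real n / real (Suc n))"
    have "\<bar>s\<bar> = \<bar>t\<bar> * (real n / real (Suc n))"
      by (simp add: s_def abs_mult)
    also have "\<dots> \<le> (real (Suc n) * \<tau>) * (real n / real (Suc n))"
      by (rule mult_right_mono[OF Suc.prems]) simp
    also have "\<dots> = real n * \<tau>" by (simp del: of_nat_Suc)
    finally have "\<bar>s\<bar> \<le> real n * \<tau>" .
    then have 1: "norm (z s) + 1 \<le> 2 ^ n * (R + 1)" by (rule Suc.IH)
    have "t - s = t / real (Suc n)"
      by (simp add: s_def field_simps)
    then have "\<bar>t - s\<bar> \<le> \<tau>"
      using Suc.prems by (simp add: abs_divide divide_le_eq mult.commute)
    then have "norm (z t) \<le> 2 * norm (z s) + 1"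
      using solution_doubling[OF c that(1)] by (simp add: \<tau>_def)
    with 1 show ?case by simp
  qed
  obtain n :: nat where n: "T / \<tau> < real n"
    using reals_Archimedean2 by blast
  show thesis
  proof
    fix z t assume z: "is_solution F z" "norm (z 0) \<le> R" "\<bar>t\<bar> \<le> T"
    have "T \<le> real n * \<tau>"
      using n \<tau> by (simp add: divide_less_eq)
    then show "norm (z t) \<le> 2 ^ n * (R + 1)"
      using *[OF z(1,2), of t n] z(3) by simp
  qed
qed

text \<open>The a priori bound on [-T, T] turns linear growth into a common bound on derivatives.
  This equicontinuity underlies all limits of solutions.\<close>

lemma solutions_lipschitz:
  assumes F: "standard_map F"
  obtains L where "L > 0" "\<And>z s t. is_solution F z \<Longrightarrow> norm (z 0) \<le> R \<Longrightarrow> \<bar>s\<bar> \<le> T \<Longrightarrow> \<bar>t\<bar> \<le> T \<Longrightarrow>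
    norm (z t - z s) \<le> L * \<bar>t - s\<bar>"
proof -
  obtain c where c: "c > 0" "\<And>x v. v \<in> F x \<Longrightarrow> norm v \<le> c * (1 + norm x)"
    using standard_map_linear_growth[OF F] by blast
  obtain B where B: "\<And>z t. is_solution F z \<Longrightarrow> norm (z 0) \<le> R \<Longrightarrow> \<bar>t\<bar> \<le> T \<Longrightarrow> norm (z t) \<le> B"
    using solutions_bounded[OF F] by blast
  define L where "L = c * (1 + \<bar>B\<bar>)"
  have le: "norm (z t - z s) \<le> L * (t - s)"
    if z: "is_solution F z" "norm (z 0) \<le> R" and st: "s \<le> t" "\<bar>s\<bar> \<le> T" "\<bar>t\<bar> \<le> T" for z s t
  proof (rule norm_increment_le[OF is_solutionD(1)[OF z(1)] st(1)])
    show "AE r in lborel. r \<in> {s..t} \<longrightarrow> (\<exists>w. (z has_vector_derivative w) (at r) \<and> norm w \<le> L)"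
      using is_solutionD(3)[OF z(1)]
    proof (rule eventually_mono, intro impI)
      fix r assume r: "\<exists>w\<in>F (z r). (z has_vector_derivative w) (at r)" "r \<in> {s..t}"
      then obtain w where w: "w \<in> F (z r)" "(z has_vector_derivative w) (at r)" by blast
      have "norm (z r) \<le> B"
        using r(2) st by (intro B[OF z]) auto
      then have "norm w \<le> L"
        using order_trans[OF c(2)[OF w(1)], of L] c(1) unfolding L_def
        by (simp add: mult_left_mono)
      with w show "\<exists>w. (z has_vector_derivative w) (at r) \<and> norm w \<le> L" by blast
    qed
  qed
  show thesis
  proof
    show "L > 0" using c(1) by (simp add: L_def)
    show "norm (z t - z s) \<le> L * \<bar>t - s\<bar>"
      if "is_solution F z" "norm (z 0) \<le> R" "\<bar>s\<bar> \<le> T" "\<bar>t\<bar> \<le> T" for z s t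
      using le[OF that(1,2), of s t] le[OF that(1,2), of t s] that
      by (cases "s \<le> t") (auto simp: norm_minus_commute)
  qed
qed

text \<open>Upper semicontinuity, in the form in which it is used for a pointwise limit of solutions.\<close>

lemma standard_map_halfspace:
  assumes F: "standard_map F" and lt: "\<And>y. y \<in> F x \<Longrightarrow> w \<bullet> y < b"
  obtains r where "r > 0" "\<And>x' y. norm (x' - x) < r \<Longrightarrow> y \<in> F x' \<Longrightarrow> w \<bullet> y < b"
proof -
  obtain c where c: "c > 0" "\<And>x v. v \<in> F x \<Longrightarrow> norm v \<le> c * (1 + norm x)"
    using standard_map_linear_growth[OF F] by blast
  have "\<exists>n. \<forall>x' y. norm (x' - x) < inverse (real (Suc n)) \<and> y \<in> F x' \<longrightarrow> w \<bullet> y < b"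
  proof (rule ccontr)
    assume "\<not> ?thesis"
    then have "\<forall>n. \<exists>x' y. norm (x' - x) < inverse (real (Suc n)) \<and> y \<in> F x' \<and> b \<le> w \<bullet> y"
      by (simp add: not_less)
    then obtain X Y where X: "\<And>n. norm (X n - x) < inverse (real (Suc n))"
      and Y: "\<And>n. Y n \<in> F (X n)" "\<And>n. b \<le> w \<bullet> Y n"
      by metis
    have lim: "X \<longlonglongrightarrow> x"
    proof (rule LIM_zero_cancel, rule Lim_null_comparison)
      show "\<forall>\<^sub>F n in sequentially. norm (X n - x) \<le> inverse (real (Suc n))"
        using X by (simp add: less_imp_le)
    qed (rule LIMSEQ_inverse_real_of_nat)
    \<comment> \<open>Linear growth bounds the values of \<open>F\<close> near \<open>x\<close>, so
      a subsequence converges and the closed graph applies to its limit.\<close>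
    have "norm (Y n) \<le> c * (2 + norm x)" for n
    proof -
      have "norm (X n - x) < 1"
        using X[of n] by (rule less_le_trans) (simp add: inverse_le_1_iff)
      then have "norm (X n) \<le> 1 + norm x"
        using norm_triangle_ineq2[of "X n" x] by simp
      then have "c * (1 + norm (X n)) \<le> c * (2 + norm x)"
        using c(1) by (intro mult_left_mono) auto
      with c(2)[OF Y(1)[of n]] show ?thesis by linarith
    qed
    then have "bounded (range Y)"
      by (auto simp: bounded_iff)
    then obtain y r where r: "strict_mono r" "(Y \<circ> r) \<longlonglongrightarrow> y"
      using bounded_imp_convergent_subsequence by blast
    have lim2: "(\<lambda>n. ((X \<circ> r) n, (Y \<circ> r) n)) \<longlonglongrightarrow> (x, y)"
      by (intro tendsto_Pair LIMSEQ_subseq_LIMSEQ[OF lim r(1)] r(2))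
    have cl: "closed {(x, z). z \<in> F x}"
      using F by (simp add: standard_map_def)
    have "((X \<circ> r) n, (Y \<circ> r) n) \<in> {(x, z). z \<in> F x}" for n
      using Y(1) by simp
    then have "(x, y) \<in> {(x, z). z \<in> F x}"
      by (rule closed_sequentially[OF cl _ lim2])
    then have "w \<bullet> y < b" using lt by simp
    moreover have "b \<le> w \<bullet> y"
      using Y(2) by (intro LIMSEQ_le_const[OF tendsto_inner[OF tendsto_const r(2)]]) auto
    ultimately show False by simp
  qed
  then obtain n where "\<And>x' y. norm (x' - x) < inverse (real (Suc n)) \<Longrightarrow> y \<in> F x' \<Longrightarrow> w \<bullet> y < b"
    by blast
  then show thesis
    by (intro that[of "inverse (real (Suc n))"]) auto
qed

section \<open>Limits of sequences of solutions\<close>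

text \<open>If a derivative \<open>v\<close> of the limit lay outside \<open>F (z t)\<close>, a
  hyperplane would separate them. By upper semicontinuity the derivatives of all late
  \<open>Z n\<close> near \<open>t\<close> stay on the side of \<open>F (z t)\<close>; the mean
  value inequality and the limits in \<open>n\<close> and then in \<open>h\<close> put
  \<open>v\<close> on that side too.\<close>

lemma is_solution_limit:
  fixes Z :: "nat \<Rightarrow> real \<Rightarrow> 'a::euclidean_space"
  assumes F: "standard_map F" and sol: "\<And>n. is_solution F (Z n)" and bd: "\<And>n. norm (Z n 0) \<le> R"
    and lim: "\<And>t. (\<lambda>n. Z n t) \<longlonglongrightarrow> z t"
  shows "is_solution F z"
proof -
  have lip: "\<exists>L>0. (\<forall>n. \<forall>s\<in>{-T..T}. \<forall>t\<in>{-T..T}. norm (Z n t - Z n s) \<le> L * \<bar>t - s\<bar>) \<and>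
       (\<forall>s\<in>{-T..T}. \<forall>t\<in>{-T..T}. norm (z t - z s) \<le> L * \<bar>t - s\<bar>)" for T
  proof -
    obtain L where L: "L > 0" "\<And>z s t. is_solution F z \<Longrightarrow> norm (z 0) \<le> R \<Longrightarrow> \<bar>s\<bar> \<le> T \<Longrightarrow> \<bar>t\<bar> \<le> T \<Longrightarrow>
      norm (z t - z s) \<le> L * \<bar>t - s\<bar>"
      using solutions_lipschitz[OF F] by blast
    have 1: "norm (Z n t - Z n s) \<le> L * \<bar>t - s\<bar>" if "s \<in> {-T..T}" "t \<in> {-T..T}" for n s t
      using that by (intro L(2) sol bd) auto
    have 2: "norm (z t - z s) \<le> L * \<bar>t - s\<bar>" if "s \<in> {-T..T}" "t \<in> {-T..T}" for s t
      using 1[OF that] by (intro LIMSEQ_le_const2[OF tendsto_norm[OF tendsto_diff[OF lim lim]]]) auto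
    show ?thesis using 1 2 L(1) by blast
  qed
  have "abs_continuous_on {a..b} z" for a b
  proof -
    define T where "T = max \<bar>a\<bar> \<bar>b\<bar>"
    obtain L where "\<forall>s\<in>{-T..T}. \<forall>t\<in>{-T..T}. norm (z t - z s) \<le> L * \<bar>t - s\<bar>"
      using lip[of T] by blast
    moreover have "{a..b} \<subseteq> {-T..T}" by (auto simp: T_def)
    ultimately show ?thesis
      by (intro abs_continuous_on_if_lipschitz[of _ _ L]) blast
  qed
  moreover have "AE t in lborel. \<exists>v. (z has_vector_derivative v) (at t)"
  proof (rule AE_differentiable_if_locally_lipschitz)
    fix N :: nat
    show "\<exists>L. \<forall>x\<in>{- real N..real N}. \<forall>y\<in>{- real N..real N}. norm (z x - z y) \<le> L * \<bar>x - y\<bar>"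
      using lip[of "real N"] by blast
  qed
  moreover have "v \<in> F (z t)" if v: "(z has_vector_derivative v) (at t)" for t v
  proof (rule ccontr)
    assume notin: "v \<notin> F (z t)"
    have "convex (F (z t))" "closed (F (z t))"
      using F by (auto simp: standard_map_def compact_imp_closed)
    from separating_hyperplane_closed_point[OF this notin]
    obtain w' b' where w': "w' \<bullet> v < b'" "\<And>y. y \<in> F (z t) \<Longrightarrow> b' < w' \<bullet> y"
      by blast
    \<comment> \<open>The sign is changed so that the values of \<open>F\<close> are bounded above,
      as the mean value inequality requires.\<close>
    define w b where "w = - w'" and "b = - b'"
    have w: "b < w \<bullet> v" "\<And>y. y \<in> F (z t) \<Longrightarrow> w \<bullet> y < b"
      using w' by (auto simp: w_def b_def)
    obtain r where r: "r > 0" "\<And>x y. norm (x - z t) < r \<Longrightarrow> y \<in> F x \<Longrightarrow> w \<bullet> y < b"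
      using standard_map_halfspace[OF F w(2)] by blast
    obtain L where L: "L > 0" "\<And>n s s'. s \<in> {-(\<bar>t\<bar>+1)..\<bar>t\<bar>+1} \<Longrightarrow> s' \<in> {-(\<bar>t\<bar>+1)..\<bar>t\<bar>+1} \<Longrightarrow>
         norm (Z n s' - Z n s) \<le> L * \<bar>s' - s\<bar>"
      using lip[of "\<bar>t\<bar> + 1"] by blast
    \<comment> \<open>The 1 keeps \<open>t + h\<close> where \<open>L\<close> is valid. The other
      term limits the drift of \<open>Z n\<close> to \<open>r / 2\<close>, leaving
      \<open>r / 2\<close> for the distance of \<open>Z n t\<close> from \<open>z t\<close>.\<close>
    define d where "d = min 1 (r / (2 * L))"
    have d: "d > 0" using r(1) L(1) by (simp add: d_def)
    have step: "w \<bullet> (z (t + h) - z t) \<le> b * h" if h: "0 < h" "h < d" for h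
    proof -
      have "\<forall>\<^sub>F n in sequentially. norm (Z n t - z t) < r / 2"
        using tendstoD[OF lim[of t], of "r / 2"] r(1) by (simp add: dist_norm)
      then have "\<forall>\<^sub>F n in sequentially. w \<bullet> (Z n (t + h) - Z n t) \<le> b * h"
      proof (rule eventually_mono)
        fix n assume n: "norm (Z n t - z t) < r / 2"
        have "w \<bullet> (Z n (t + h) - Z n t) \<le> b * ((t + h) - t)"
        proof (rule inner_increment_le[OF is_solutionD(1)[OF sol]])
          show "AE s in lborel. s \<in> {t..t + h} \<longrightarrow> (\<exists>v. (Z n has_vector_derivative v) (at s) \<and> w \<bullet> v \<le> b)"
            using is_solutionD(3)[OF sol]
          proof (rule eventually_mono, intro impI)
            fix s assume s: "\<exists>v\<in>F (Z n s). (Z n has_vector_derivative v) (at s)" "s \<in> {t..t + h}"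
            then obtain v where v: "v \<in> F (Z n s)" "(Z n has_vector_derivative v) (at s)" by blast
            have "norm (Z n s - Z n t) \<le> L * \<bar>s - t\<bar>"
              using s(2) h by (intro L(2)) (auto simp: d_def)
            also have "\<dots> \<le> L * (r / (2 * L))"
              using s(2) h L(1) by (intro mult_left_mono) (auto simp: d_def)
            also have "\<dots> = r / 2" using L(1) by simp
            finally have "norm (Z n s - z t) < r"
              using n norm_triangle_ineq[of "Z n s - Z n t" "Z n t - z t"] by simp
            from r(2)[OF this v(1)] v(2)
            show "\<exists>v. (Z n has_vector_derivative v) (at s) \<and> w \<bullet> v \<le> b" by (auto intro: less_imp_le)
          qed
        qed (use h in simp)
        then show "w \<bullet> (Z n (t + h) - Z n t) \<le> b * h" by simp
      qed
      then show ?thesis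
        by (intro tendsto_upperbound[OF tendsto_inner[OF tendsto_const tendsto_diff[OF lim lim]]]) auto
    qed
    have "((\<lambda>s. w \<bullet> z s) has_real_derivative w \<bullet> v) (at t)"
      using v unfolding has_vector_derivative_def has_field_derivative_def
      by (auto intro!: derivative_eq_intros simp: mult.commute[of "w \<bullet> v"])
    then have "((\<lambda>h. (w \<bullet> z (t + h) - w \<bullet> z t) / h) \<longlongrightarrow> w \<bullet> v) (at 0)"
      by (simp add: DERIV_def)
    then have "((\<lambda>h. (w \<bullet> z (t + h) - w \<bullet> z t) / h) \<longlongrightarrow> w \<bullet> v) (at_right 0)"
      by (rule filterlim_at_split[THEN iffD1, THEN conjunct2])
    moreover have "\<forall>\<^sub>F h in at_right 0. (w \<bullet> z (t + h) - w \<bullet> z t) / h \<le> b"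
      using step d by (auto simp: eventually_at_right_field inner_diff_right divide_le_eq intro!: exI[of _ d])
    ultimately have "w \<bullet> v \<le> b"
      by (intro tendsto_upperbound) auto
    with w(1) show False by simp
  qed
  ultimately show ?thesis
    unfolding is_solution_def by (auto elim!: eventually_mono)
qed

text \<open>Arzela-Ascoli by hand: a diagonal subsequence converges at the rationals, and the common
  Lipschitz constants carry the Cauchy property to all times.\<close>

lemma solutions_compact:
  fixes Z :: "nat \<Rightarrow> real \<Rightarrow> 'a::euclidean_space"
  assumes F: "standard_map F" and sol: "\<And>n. is_solution F (Z n)" and bd: "\<And>n. norm (Z n 0) \<le> R"
  obtains k z where "strict_mono k" "is_solution F z" "\<And>t. (\<lambda>n. Z (k n) t) \<longlonglongrightarrow> z t"
proof -
  have "\<exists>B>0. \<forall>n. norm (Z n t) \<le> B" for t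
  proof -
    obtain B where "\<And>z s. is_solution F z \<Longrightarrow> norm (z 0) \<le> R \<Longrightarrow> \<bar>s\<bar> \<le> \<bar>t\<bar> \<Longrightarrow> norm (z s) \<le> B"
      using solutions_bounded[OF F] by blast
    then have "\<forall>n. norm (Z n t) \<le> B" using sol bd by blast
    then show ?thesis
      by (intro exI[of _ "max B 1"]) (auto simp: le_max_iff_disj)
  qed
  then obtain B where B: "\<And>t. B t > 0" "\<And>t n. norm (Z n t) \<le> B t"
    by metis
  \<comment> \<open>The bounds grow with \<open>t\<close>, whereas the diagonal argument asks for
    one bound at all times; hence the rescaling.\<close>
  have "norm (Z n t /\<^sub>R B t) \<le> 1" for n t
    using B(1)[of t] B(2)[of n t] by (simp add: field_simps)
  then obtain k :: "nat \<Rightarrow> nat" where k: "strict_mono k"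
    "\<And>t. t \<in> \<rat> \<Longrightarrow> \<exists>l. (\<lambda>n. Z (k n) t /\<^sub>R B t) \<longlonglongrightarrow> l"
    using function_convergent_subsequence[of \<rat> "\<lambda>n t. Z n t /\<^sub>R B t" 1] countable_rat by blast
  have rat: "convergent (\<lambda>n. Z (k n) t)" if t: "t \<in> \<rat>" for t
  proof -
    obtain l where "(\<lambda>n. Z (k n) t /\<^sub>R B t) \<longlonglongrightarrow> l"
      using k(2)[OF t] by blast
    from tendsto_scaleR[OF tendsto_const[of "B t"] this] B(1)[of t]
    show ?thesis by (auto simp: convergent_def)
  qed
  have "convergent (\<lambda>n. Z (k n) t)" for t
  proof (rule Cauchy_convergent, rule metric_CauchyI)
    fix e :: real assume e: "e > 0"
    obtain L where L: "L > 0" "\<And>z s s'. is_solution F z \<Longrightarrow> norm (z 0) \<le> R \<Longrightarrow> \<bar>s\<bar> \<le> \<bar>t\<bar> + 1 \<Longrightarrow> \<bar>s'\<bar> \<le> \<bar>t\<bar> + 1 \<Longrightarrow>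
      norm (z s' - z s) \<le> L * \<bar>s' - s\<bar>"
      using solutions_lipschitz[OF F] by blast
    define d where "d = min 1 (e / (3 * L))"
    have d: "d > 0" using e L by (simp add: d_def)
    obtain q where q: "q \<in> \<rat>" "t < q" "q < t + d"
      using Rats_dense_in_real[of t "t + d"] d by auto
    have near: "norm (Z n t - Z n q) < e / 3" for n
    proof -
      have "norm (Z n t - Z n q) \<le> L * \<bar>t - q\<bar>"
        using q by (intro L(2) sol bd) (auto simp: d_def)
      also have "\<dots> < L * (e / (3 * L))"
        using q L(1) by (intro mult_strict_left_mono) (auto simp: d_def)
      finally show ?thesis using L(1) by simp
    qed
    obtain M where M: "\<And>m n. m \<ge> M \<Longrightarrow> n \<ge> M \<Longrightarrow> dist (Z (k m) q) (Z (k n) q) < e / 3"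
      using metric_CauchyD[OF convergent_Cauchy[OF rat[OF q(1)]], of "e / 3"] e by auto
    have "dist (Z (k m) t) (Z (k n) t) < e" if "m \<ge> M" "n \<ge> M" for m n
    proof -
      have "Z (k m) t - Z (k n) t = (Z (k m) t - Z (k m) q) + (Z (k m) q - Z (k n) q) - (Z (k n) t - Z (k n) q)"
        by simp
      also have "norm \<dots> \<le> norm (Z (k m) t - Z (k m) q) + norm (Z (k m) q - Z (k n) q) + norm (Z (k n) t - Z (k n) q)"
        by (meson norm_triangle_ineq norm_triangle_ineq4 order_trans add_right_mono)
      also have "\<dots> < e"
        using near[of "k m"] near[of "k n"] M[OF that] by (simp add: dist_norm)
      finally show ?thesis by (simp add: dist_norm)
    qed
    then show "\<exists>M. \<forall>m\<ge>M. \<forall>n\<ge>M. dist (Z (k m) t) (Z (k n) t) < e"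
      by blast
  qed
  then obtain z where z: "\<And>t. (\<lambda>n. Z (k n) t) \<longlonglongrightarrow> z t"
    unfolding convergent_def by metis
  show thesis
    by (rule that[OF k(1) is_solution_limit[OF F sol bd z] z])
qed

section \<open>Entering a neighbourhood of the attractor from its basin\<close>

text \<open>Otherwise points of the flow at the times \<open>Suc n\<close> stay at distance at least
  \<open>e\<close> from \<open>A\<close>. The forward orbit is bounded, so they accumulate at a
  point of the omega limit set, hence of \<open>A\<close>.\<close>

lemma basin_reaches_neighborhood:
  assumes F: "standard_map F" and p: "p \<in> basin F A" and e: "e > 0"
  obtains T where "T > 0" "flow F T p \<subseteq> {y. infdist y A < e}"
proof -
  have "\<exists>n. flow F (real (Suc n)) p \<subseteq> {y. infdist y A < e}"
  proof (rule ccontr)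
    assume "\<not> ?thesis"
    then obtain Y where Y: "\<And>n. Y n \<in> flow F (real (Suc n)) p" "\<And>n. infdist (Y n) A \<ge> e"
      unfolding not_ex subset_iff not_all not_imp mem_Collect_eq not_less by metis
    have "bounded (\<Union>t\<in>{0..}. flow F t p)"
      using p by (simp add: basin_def)
    moreover have "range Y \<subseteq> (\<Union>t\<in>{0..}. flow F t p)"
      using Y(1) by (auto intro!: UN_I[of "real (Suc _)"])
    ultimately have "bounded (range Y)"
      by (rule bounded_subset)
    then obtain y r where r: "strict_mono r" "(Y \<circ> r) \<longlonglongrightarrow> y"
      using bounded_imp_convergent_subsequence by blast
    have "y \<in> closure (\<Union>s\<in>{t..}. flow F s p)" if "t \<ge> 0" for t
    proof (rule Lim_in_closed_set[OF closed_closure _ _ r(2)])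
      obtain N :: nat where N: "t \<le> real N"
        using real_arch_simple by blast
      show "\<forall>\<^sub>F n in sequentially. (Y \<circ> r) n \<in> closure (\<Union>s\<in>{t..}. flow F s p)"
      proof (rule eventually_sequentiallyI[of N])
        fix n assume "N \<le> n"
        then have "t \<le> real (Suc (r n))"
          using N seq_suble[OF r(1), of n] by linarith
        then have "(Y \<circ> r) n \<in> (\<Union>s\<in>{t..}. flow F s p)"
          using Y(1)[of "r n"] by auto
        then show "(Y \<circ> r) n \<in> closure (\<Union>s\<in>{t..}. flow F s p)"
          by (rule subsetD[OF closure_subset])
      qed
    qed simp
    then have "y \<in> omega_limit F p"
      by (simp add: omega_limit_def)
    then have "infdist y A = 0"
      using p by (auto simp: basin_def)
    moreover have "e \<le> infdist y A"
      using Y(2) by (intro LIMSEQ_le_const[OF tendsto_infdist[OF r(2)]]) auto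
    ultimately show False using e by simp
  qed
  then obtain n where "flow F (real (Suc n)) p \<subseteq> {y. infdist y A < e}" by blast
  then show thesis by (rule that[rotated]) simp
qed

text \<open>The tolerance \<open>d\<close> is what allows a shadowing solution to start only near
  \<open>p\<close>; it comes from compactness, since solutions from points tending to
  \<open>p\<close> have a limit solution from \<open>p\<close>.\<close>

lemma basin_reaches_neighborhood_uniformly:
  assumes F: "standard_map F" and p: "p \<in> basin F A" and e: "e > 0"
  obtains T d where "T > 0" "d > 0"
    "\<And>z. is_solution F z \<Longrightarrow> norm (z 0 - p) < d \<Longrightarrow> infdist (z T) A < e"
proof -
  obtain T where T: "T > 0" "flow F T p \<subseteq> {y. infdist y A < e}"
    using basin_reaches_neighborhood[OF F p e] by blast
  have "\<exists>n. \<forall>z. is_solution F z \<and> norm (z 0 - p) < inverse (real (Suc n)) \<longrightarrow> infdist (z T) A < e"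
  proof (rule ccontr)
    assume "\<not> ?thesis"
    then obtain Z where Z: "\<And>n. is_solution F (Z n)" "\<And>n. norm (Z n 0 - p) < inverse (real (Suc n))"
      "\<And>n. e \<le> infdist (Z n T) A"
      unfolding not_ex not_all not_imp not_less by metis
    have lim: "(\<lambda>n. Z n 0) \<longlonglongrightarrow> p"
    proof (rule LIM_zero_cancel, rule Lim_null_comparison)
      show "\<forall>\<^sub>F n in sequentially. norm (Z n 0 - p) \<le> inverse (real (Suc n))"
        using Z(2) by (simp add: less_imp_le)
    qed (rule LIMSEQ_inverse_real_of_nat)
    have bd: "norm (Z n 0) \<le> 1 + norm p" for n
    proof -
      have "norm (Z n 0 - p) < 1"
        using Z(2)[of n] by (rule less_le_trans) (simp add: inverse_le_1_iff)
      then show ?thesis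
        using norm_triangle_ineq2[of "Z n 0" p] by simp
    qed
    obtain k z where k: "strict_mono k" "is_solution F z" "\<And>t. (\<lambda>n. Z (k n) t) \<longlonglongrightarrow> z t"
      using solutions_compact[of F Z, OF F Z(1) bd] by blast
    have "z 0 = p"
      using LIMSEQ_unique[OF k(3)[of 0]] LIMSEQ_subseq_LIMSEQ[OF lim k(1)] by (simp add: o_def)
    then have "z T \<in> flow F T p"
      using k(2) by (auto simp: flow_def solutions_from_def)
    then have "infdist (z T) A < e" using T(2) by blast
    moreover have "e \<le> infdist (z T) A"
      using Z(3) by (intro LIMSEQ_le_const[OF tendsto_infdist[OF k(3)]]) auto
    ultimately show False by simp
  qed
  then obtain n where "\<And>z. is_solution F z \<Longrightarrow> norm (z 0 - p) < inverse (real (Suc n)) \<Longrightarrow> infdist (z T) A < e"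
    by blast
  then show thesis
    by (intro that[of T "inverse (real (Suc n))"] T) auto
qed

section \<open>Measurability of the shadowing events\<close>

lemma SUP_norm_dense:
  fixes f :: "real \<Rightarrow> 'a::real_normed_vector"
  assumes f: "continuous_on S f" and C: "C \<subseteq> S" "S \<subseteq> closure C"
  shows "(SUP u\<in>S. ereal (norm (f u))) = (SUP u\<in>C. ereal (norm (f u)))"
proof (rule antisym)
  show "(SUP u\<in>S. ereal (norm (f u))) \<le> (SUP u\<in>C. ereal (norm (f u)))"
  proof (rule SUP_least)
    fix u assume u: "u \<in> S"
    then obtain c where c: "\<And>n. c n \<in> C" "c \<longlonglongrightarrow> u"
      using C(2) closure_sequential by blast
    have "(\<lambda>n. f (c n)) \<longlonglongrightarrow> f u"
      by (rule continuous_on_tendsto_compose[OF f c(2) u]) (use c(1) C(1) in \<open>auto intro!: always_eventually\<close>)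
    then have "(\<lambda>n. ereal (norm (f (c n)))) \<longlonglongrightarrow> ereal (norm (f u))"
      by (intro tendsto_intros)
    then show "ereal (norm (f u)) \<le> (SUP u\<in>C. ereal (norm (f u)))"
      by (rule LIMSEQ_le_const2) (auto intro!: SUP_upper c(1))
  qed
  show "(SUP u\<in>C. ereal (norm (f u))) \<le> (SUP u\<in>S. ereal (norm (f u)))"
    by (rule SUP_subset_mono[OF C(1) order_refl])
qed

lemma unif_norm_le_add:
  fixes f g :: "real \<Rightarrow> 'a::real_normed_vector"
  assumes "\<And>u. u \<in> {0..T} \<Longrightarrow> norm (f u - g u) \<le> e"
  shows "unif_norm T f \<le> unif_norm T g + ereal e"
  unfolding unif_norm_def
proof (rule SUP_least)
  fix u assume u: "u \<in> {0..T}"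
  have "norm (f u) \<le> norm (g u) + e"
    using norm_triangle_ineq2[of "f u" "g u"] assms[OF u] by simp
  then have "ereal (norm (f u)) \<le> ereal (norm (g u)) + ereal e" by simp
  also have "\<dots> \<le> (SUP u\<in>{0..T}. ereal (norm (g u))) + ereal e"
    by (intro add_right_mono SUP_upper u)
  finally show "ereal (norm (f u)) \<le> (SUP u\<in>{0..T}. ereal (norm (g u))) + ereal e" .
qed

lemma INF_ereal_le_add:
  fixes f g :: "'i \<Rightarrow> ereal"
  assumes "\<And>i. i \<in> I \<Longrightarrow> f i \<le> g i + ereal e"
  shows "(INF i\<in>I. f i) \<le> (INF i\<in>I. g i) + ereal e"
proof -
  have "(INF i\<in>I. f i) - ereal e \<le> (INF i\<in>I. g i)"
  proof (rule INF_greatest)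
    fix i assume i: "i \<in> I"
    have "(INF i\<in>I. f i) \<le> g i + ereal e"
      using assms[OF i] INF_lower[OF i, of f] by (rule order_trans[rotated])
    then show "(INF i\<in>I. f i) - ereal e \<le> g i"
      by (simp add: ereal_minus_le)
  qed
  then show ?thesis by (simp add: ereal_minus_le)
qed

text \<open>Step functions with values in a countable dense set approximate every continuous function
  uniformly, and there are only countably many of them.\<close>

lemma countable_uniformly_dense:
  fixes S :: "(real \<Rightarrow> 'a::euclidean_space) set"
  assumes cont: "\<And>z. z \<in> S \<Longrightarrow> continuous_on {0..T} z"
  obtains D where "countable D" "D \<subseteq> S"
    "\<And>z e. z \<in> S \<Longrightarrow> e > 0 \<Longrightarrow> \<exists>y\<in>D. \<forall>u\<in>{0..T}. norm (z u - y u) \<le> e"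
proof -
  obtain Q :: "'a set" where Q: "countable Q" "UNIV \<subseteq> closure Q"
    by (rule separable[of "UNIV :: 'a set"])
  define g :: "'a list \<Rightarrow> nat \<Rightarrow> real \<Rightarrow> 'a" where "g l n u = l ! nat \<lfloor>real n * u\<rfloor>" for l n u
  define near where "near i z \<longleftrightarrow> (case i of (l, n, k) \<Rightarrow> \<forall>u\<in>{0..T}. norm (z u - g l n u) < inverse (real (Suc k)))" for i z
  define I where "I = {i \<in> lists Q \<times> (UNIV :: (nat \<times> nat) set). \<exists>z\<in>S. near i z}"
  \<comment> \<open>The step functions themselves need not lie in \<open>S\<close>; each one that is
    close to some member of \<open>S\<close> is replaced by such a member.\<close>
  define pick where "pick i = (SOME z. z \<in> S \<and> near i z)" for i
  have pick: "pick i \<in> S" "near i (pick i)" if "i \<in> I" for i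
    using that someI_ex[of "\<lambda>z. z \<in> S \<and> near i z"] unfolding I_def pick_def by blast+
  have "countable I"
    unfolding I_def using Q(1) by (intro countable_Collect countable_SIGMA countable_lists) auto
  then have "countable (pick ` I)" by simp
  moreover have "pick ` I \<subseteq> S" using pick by blast
  moreover have "\<exists>y\<in>pick ` I. \<forall>u\<in>{0..T}. norm (z u - y u) \<le> e" if z: "z \<in> S" and e: "e > 0" for z e
  proof -
    obtain k where k: "inverse (real (Suc k)) < e / 2"
      using reals_Archimedean[of "e / 2"] e by auto
    define e' where "e' = inverse (real (Suc k))"
    have e': "e' > 0" by (simp add: e'_def)
    have "uniformly_continuous_on {0..T} z"
      using cont[OF z] by (rule compact_uniformly_continuous) simp
    then obtain d where d: "d > 0" "\<And>u v. u \<in> {0..T} \<Longrightarrow> v \<in> {0..T} \<Longrightarrow> dist v u < d \<Longrightarrow> dist (z v) (z u) < e' / 2"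
      unfolding uniformly_continuous_on_def using e' by (metis half_gt_zero)
    obtain n' where n': "inverse (real (Suc n')) < d"
      using reals_Archimedean[OF d(1)] by blast
    define n where "n = Suc n'"
    have n: "n > 0" "1 / real n < d" using n' by (simp_all add: n_def inverse_eq_divide)
    have "\<exists>q\<in>Q. dist q (z (real j / real n)) < e' / 2" for j
      using Q(2) closure_approachable[of "z (real j / real n)" Q] e' by (metis UNIV_I half_gt_zero subsetD)
    then obtain q where q: "\<And>j. q j \<in> Q" "\<And>j. dist (q j) (z (real j / real n)) < e' / 2"
      by metis
    \<comment> \<open>The \<open>Suc\<close> provides an entry for the last grid cell, which
      contains \<open>u = T\<close>.\<close>
    define l where "l = map q [0..<Suc (nat \<lfloor>real n * T\<rfloor>)]"
    have "l \<in> lists Q" using q(1) by (auto simp: l_def)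
    moreover have near: "near (l, n, k) z"
      unfolding near_def prod.case e'_def[symmetric]
    proof
      fix u assume u: "u \<in> {0..T}"
      define j where "j = nat \<lfloor>real n * u\<rfloor>"
      have jl: "real j \<le> real n * u" "real n * u < real j + 1"
        using u by (simp_all add: j_def)
      have "real n * u \<le> real n * T" using u by (intro mult_left_mono) auto
      then have "j < Suc (nat \<lfloor>real n * T\<rfloor>)"
        unfolding j_def by (meson floor_mono le_imp_less_Suc nat_mono)
      then have g: "g l n u = q j"
        by (simp add: g_def l_def j_def[symmetric] del: upt_Suc)
      have ju: "real j / real n \<le> u" "u < real j / real n + 1 / real n"
        using jl n(1) by (auto simp: field_simps)
      have "dist (z u) (z (real j / real n)) < e' / 2"
        using ju u n by (intro d(2)) (auto simp: dist_real_def intro: order_trans)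
      then have "dist (z u) (q j) < e'"
        using q(2)[of j] dist_triangle[of "z u" "q j" "z (real j / real n)"]
        unfolding dist_commute[of "q j"] by linarith
      then show "norm (z u - g l n u) < e'"
        by (simp add: g dist_norm)
    qed
    ultimately have i: "(l, n, k) \<in> I" using z by (auto simp: I_def)
    have "norm (z u - pick (l, n, k) u) \<le> e" if u: "u \<in> {0..T}" for u
    proof -
      have "norm (z u - g l n u) < inverse (real (Suc k))"
        using near[unfolded near_def prod.case] u by (rule bspec)
      moreover have "norm (pick (l, n, k) u - g l n u) < inverse (real (Suc k))"
        using pick(2)[OF i, unfolded near_def prod.case] u by (rule bspec)
      ultimately show ?thesis
        using k norm_triangle_ineq4[of "z u - g l n u" "pick (l, n, k) u - g l n u"] by simp
    qed
    then show ?thesis using i by blast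
  qed
  ultimately show thesis by (rule that)
qed

lemma measurable_unif_norm:
  fixes X :: "real \<Rightarrow> 'w \<Rightarrow> 'a::euclidean_space"
  assumes X: "\<And>t. t \<ge> 0 \<Longrightarrow> X t \<in> borel_measurable P"
    and cont: "\<And>w. w \<in> space P \<Longrightarrow> continuous_on {0..} (\<lambda>t. X t w)"
    and z: "continuous_on {0..T} z" and s: "s \<ge> 0"
  shows "(\<lambda>w. unif_norm T (\<lambda>u. z u - X (s + u) w)) \<in> borel_measurable P"
proof -
  obtain C where C: "countable C" "C \<subseteq> {0..T}" "{0..T} \<subseteq> closure C"
    by (rule separable[of "{0..T}"])
  have "unif_norm T (\<lambda>u. z u - X (s + u) w) = (SUP u\<in>C. ereal (norm (z u - X (s + u) w)))"
    if "w \<in> space P" for w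
    unfolding unif_norm_def using C(2,3) s
    by (intro SUP_norm_dense continuous_intros z continuous_on_compose2[OF cont[OF that]]) auto
  moreover have "(\<lambda>w. SUP u\<in>C. ereal (norm (z u - X (s + u) w))) \<in> borel_measurable P"
  proof (rule borel_measurable_SUP[OF C(1)])
    fix u assume "u \<in> C"
    then have "X (s + u) \<in> borel_measurable P" using C(2) s by (intro X) auto
    then show "(\<lambda>w. ereal (norm (z u - X (s + u) w))) \<in> borel_measurable P"
      by measurable
  qed
  ultimately show ?thesis by (simp cong: measurable_cong)
qed

text \<open>The infimum over uncountably many curves equals that over a countable uniformly dense
  subset, which is the same for all \<open>w\<close>.\<close>

lemma measurable_INF_unif_norm:
  fixes X :: "real \<Rightarrow> 'w \<Rightarrow> 'a::euclidean_space"
  assumes X: "\<And>t. t \<ge> 0 \<Longrightarrow> X t \<in> borel_measurable P"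
    and cont: "\<And>w. w \<in> space P \<Longrightarrow> continuous_on {0..} (\<lambda>t. X t w)"
    and S: "\<And>z. z \<in> S \<Longrightarrow> continuous_on {0..T} z" and s: "s \<ge> 0"
  shows "(\<lambda>w. INF z\<in>S. unif_norm T (\<lambda>u. z u - X (s + u) w)) \<in> borel_measurable P"
proof -
  obtain D where D: "countable D" "D \<subseteq> S"
    "\<And>z e. z \<in> S \<Longrightarrow> e > 0 \<Longrightarrow> \<exists>y\<in>D. \<forall>u\<in>{0..T}. norm (z u - y u) \<le> e"
    using countable_uniformly_dense[OF S] by blast
  have "(INF z\<in>S. unif_norm T (\<lambda>u. z u - X (s + u) w)) = (INF z\<in>D. unif_norm T (\<lambda>u. z u - X (s + u) w))" for w
  proof (rule antisym)
    show "(INF z\<in>S. unif_norm T (\<lambda>u. z u - X (s + u) w)) \<le> (INF z\<in>D. unif_norm T (\<lambda>u. z u - X (s + u) w))"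
      by (rule INF_superset_mono[OF D(2) order_refl])
    show "(INF z\<in>D. unif_norm T (\<lambda>u. z u - X (s + u) w)) \<le> (INF z\<in>S. unif_norm T (\<lambda>u. z u - X (s + u) w))"
    proof (rule INF_greatest, rule ereal_le_epsilon2)
      fix z and e :: real assume "z \<in> S" "e > 0"
      then obtain y where y: "y \<in> D" "\<And>u. u \<in> {0..T} \<Longrightarrow> norm (z u - y u) \<le> e"
        using D(3) by blast
      have "(INF z\<in>D. unif_norm T (\<lambda>u. z u - X (s + u) w)) \<le> unif_norm T (\<lambda>u. y u - X (s + u) w)"
        using y(1) by (rule INF_lower)
      also have "\<dots> \<le> unif_norm T (\<lambda>u. z u - X (s + u) w) + ereal e"
        using y(2) by (intro unif_norm_le_add) (simp add: norm_minus_commute)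
      finally show "(INF z\<in>D. unif_norm T (\<lambda>u. z u - X (s + u) w)) \<le> unif_norm T (\<lambda>u. z u - X (s + u) w) + ereal e" .
    qed
  qed
  moreover have "(\<lambda>w. INF z\<in>D. unif_norm T (\<lambda>u. z u - X (s + u) w)) \<in> borel_measurable P"
    using D(1,2) S by (intro borel_measurable_INF measurable_unif_norm X cont s) auto
  ultimately show ?thesis by simp
qed

lemma measurable_SUP_INF_unif_norm:
  fixes X :: "real \<Rightarrow> 'w \<Rightarrow> 'a::euclidean_space"
  assumes X: "\<And>t. t \<ge> 0 \<Longrightarrow> X t \<in> borel_measurable P"
    and cont: "\<And>w. w \<in> space P \<Longrightarrow> continuous_on {0..} (\<lambda>t. X t w)"
    and S: "\<And>z. z \<in> S \<Longrightarrow> continuous_on {0..T} z" and t: "t \<ge> 0"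
  shows "(\<lambda>w. SUP s\<in>{t..}. INF z\<in>S. unif_norm T (\<lambda>u. z u - X (s + u) w)) \<in> borel_measurable P"
proof -
  define d where "d s w = (INF z\<in>S. unif_norm T (\<lambda>u. z u - X (s + u) w))" for s w
  have "(SUP s\<in>{t..}. d s w) = (SUP s\<in>{t..} \<inter> \<rat>. d s w)" if w: "w \<in> space P" for w
  proof (rule antisym)
    show "(SUP s\<in>{t..} \<inter> \<rat>. d s w) \<le> (SUP s\<in>{t..}. d s w)"
      by (rule SUP_subset_mono) auto
    show "(SUP s\<in>{t..}. d s w) \<le> (SUP s\<in>{t..} \<inter> \<rat>. d s w)"
    proof (rule SUP_least, rule ereal_le_epsilon2)
      fix s and e :: real assume s: "s \<in> {t..}" and e: "e > 0"
      \<comment> \<open>A rational \<open>r < s + 1\<close> will replace \<open>s\<close>, so the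
        times \<open>r + u\<close> with \<open>u \<le> T\<close> stay in this interval.\<close>
      have "uniformly_continuous_on {s..s + 1 + T} (\<lambda>t. X t w)"
        using s t by (intro compact_uniformly_continuous continuous_on_subset[OF cont[OF w]]) auto
      then obtain \<delta> where \<delta>: "\<delta> > 0" "\<And>u v. u \<in> {s..s + 1 + T} \<Longrightarrow> v \<in> {s..s + 1 + T} \<Longrightarrow> dist v u < \<delta> \<Longrightarrow> dist (X v w) (X u w) < e"
        unfolding uniformly_continuous_on_def using e by metis
      obtain r where r: "r \<in> \<rat>" "s < r" "r < s + min 1 \<delta>"
        using Rats_dense_in_real[of s "s + min 1 \<delta>"] \<delta>(1) by auto
      have near: "norm (X (r + u) w - X (s + u) w) \<le> e" if "u \<in> {0..T}" for u
      proof -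
        have "dist (X (r + u) w) (X (s + u) w) < e"
          using r that by (intro \<delta>(2)) (auto simp: dist_real_def)
        then show ?thesis by (simp add: dist_norm)
      qed
      have "d s w \<le> d r w + ereal e"
        unfolding d_def using near by (intro INF_ereal_le_add unif_norm_le_add) (simp add: norm_minus_commute)
      also have "\<dots> \<le> (SUP s\<in>{t..} \<inter> \<rat>. d s w) + ereal e"
        using r s by (intro add_right_mono SUP_upper) auto
      finally show "d s w \<le> (SUP s\<in>{t..} \<inter> \<rat>. d s w) + ereal e" .
    qed
  qed
  moreover have "(\<lambda>w. SUP s\<in>{t..} \<inter> \<rat>. d s w) \<in> borel_measurable P"
    unfolding d_def using t
    by (intro borel_measurable_SUP measurable_INF_unif_norm X cont S) (auto intro: countable_rat countable_subset)
  ultimately show ?thesis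
    unfolding d_def by (simp cong: measurable_cong)
qed

section \<open>Measurability of convergence to a compact set\<close>

text \<open>The bound on the norm in the exceptional sets makes repeated visits accumulate. It is
  essential because an unbounded path may have a small or even empty limit set while staying away
  from \<open>A\<close>.\<close>

lemma limit_set_subset_iff:
  fixes x :: "real \<Rightarrow> 'a::euclidean_space"
  assumes A: "compact A" "A \<noteq> {}"
  shows "limit_set x \<subseteq> A \<longleftrightarrow>
    (\<forall>n::nat. \<exists>N::nat. \<forall>s\<ge>real N. x s \<notin> {y. norm y < real n \<and> inverse (real (Suc n)) < infdist y A})"
    (is "_ \<longleftrightarrow> (\<forall>n. \<exists>N. \<forall>s\<ge>real N. x s \<notin> ?O n)")
proof
  assume sub: "limit_set x \<subseteq> A"
  show "\<forall>n. \<exists>N. \<forall>s\<ge>real N. x s \<notin> ?O n"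
  proof (rule allI, rule ccontr)
    fix n assume "\<not> (\<exists>N. \<forall>s\<ge>real N. x s \<notin> ?O n)"
    then obtain s where s: "\<And>N. s N \<ge> real N" "\<And>N. x (s N) \<in> ?O n"
      by metis
    have "bounded (range (\<lambda>N. x (s N)))"
      using s(2) by (intro boundedI[of _ "real n"]) (auto intro: less_imp_le)
    then obtain y r where r: "strict_mono r" "((\<lambda>N. x (s N)) \<circ> r) \<longlonglongrightarrow> y"
      using bounded_imp_convergent_subsequence by blast
    have "y \<in> closure (x ` {t..})" for t
    proof (rule Lim_in_closed_set[OF closed_closure _ _ r(2)])
      obtain N :: nat where N: "t \<le> real N"
        using real_arch_simple by blast
      show "\<forall>\<^sub>F n in sequentially. ((\<lambda>N. x (s N)) \<circ> r) n \<in> closure (x ` {t..})"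
      proof (rule eventually_sequentiallyI[of N])
        fix n assume "N \<le> n"
        then have "t \<le> s (r n)"
          using N seq_suble[OF r(1), of n] s(1)[of "r n"] by linarith
        then have "x (s (r n)) \<in> x ` {t..}" by simp
        then show "((\<lambda>N. x (s N)) \<circ> r) n \<in> closure (x ` {t..})"
          using closure_subset by fastforce
      qed
    qed simp
    then have "y \<in> A" using sub by (auto simp: limit_set_def)
    then have "infdist y A = 0" by simp
    moreover have "inverse (real (Suc n)) \<le> infdist y A"
      using s(2) by (intro LIMSEQ_le_const[OF tendsto_infdist[OF r(2)]]) (auto intro: less_imp_le)
    ultimately show False by simp
  qed
next
  assume ev: "\<forall>n. \<exists>N. \<forall>s\<ge>real N. x s \<notin> ?O n"
  show "limit_set x \<subseteq> A"
  proof (rule subsetI, rule ccontr)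
    fix y assume y: "y \<in> limit_set x" "y \<notin> A"
    have "infdist y A > 0"
      using y(2) A by (simp add: infdist_pos_not_in_closed compact_imp_closed)
    then obtain m where m: "inverse (real (Suc m)) < infdist y A"
      using reals_Archimedean by blast
    obtain n :: nat where n: "max (norm y) (real m) < real n"
      using reals_Archimedean2 by blast
    have "inverse (real (Suc n)) \<le> inverse (real (Suc m))"
      using n by (intro le_imp_inverse_le) auto
    with m have "inverse (real (Suc n)) < infdist y A" by linarith
    with n have yO: "y \<in> ?O n" by simp
    have "open (?O n)"
      by (intro open_Collect_conj open_Collect_less continuous_intros)
    obtain N where N: "\<And>s. s \<ge> real N \<Longrightarrow> x s \<notin> ?O n" using ev by blast
    have "y \<in> closure (x ` {real N..})"
      using y(1) by (simp add: limit_set_def)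
    with yO have "?O n \<inter> closure (x ` {real N..}) \<noteq> {}" by blast
    then have "?O n \<inter> x ` {real N..} \<noteq> {}"
      by (simp only: open_Int_closure_eq_empty[OF \<open>open (?O n)\<close>] not_False_eq_True)
    then obtain s where "s \<ge> real N" "x s \<in> ?O n" by blast
    with N show False by blast
  qed
qed

lemma ex_visit_open_iff_rat:
  fixes x :: "real \<Rightarrow> 'a::topological_space"
  assumes x: "continuous_on {0..} x" and U: "open U" and t: "t \<ge> 0"
  shows "(\<exists>s\<ge>t. x s \<in> U) \<longleftrightarrow> (\<exists>s\<in>{t..} \<inter> \<rat>. x s \<in> U)"
proof
  assume "\<exists>s\<ge>t. x s \<in> U"
  then obtain s where s: "s \<ge> t" "x s \<in> U" by blast
  from x[unfolded continuous_on_open_invariant, rule_format, OF U]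
  obtain V where V: "open V" "V \<inter> {0..} = x -` U \<inter> {0..}"
    by blast
  have "s \<in> x -` U \<inter> {0..}" using s t by simp
  then have "s \<in> V" using V(2) by blast
  then obtain e where e: "e > 0" "ball s e \<subseteq> V"
    using V(1) openE by blast
  \<comment> \<open>Approaching \<open>s\<close> from the right keeps \<open>r\<close> above
    \<open>t\<close> and in the domain of continuity.\<close>
  obtain r where r: "r \<in> \<rat>" "s < r" "r < s + e"
    using Rats_dense_in_real[of s "s + e"] e(1) by auto
  have "r \<in> V" using r e(2) by (auto simp: dist_real_def)
  moreover have "r \<in> {0..}" using r s t by simp
  ultimately have "x r \<in> U" using V(2) by blast
  then show "\<exists>s\<in>{t..} \<inter> \<rat>. x s \<in> U" using r s by auto
qed auto

text \<open>Since \<open>measure\<close> is 0 on non-measurable sets, a lower bound for the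
  probability of this event rests on its measurability.\<close>

lemma sets_limit_set_subset:
  fixes X :: "real \<Rightarrow> 'w \<Rightarrow> 'a::euclidean_space"
  assumes X: "\<And>t. t \<ge> 0 \<Longrightarrow> X t \<in> borel_measurable P"
    and cont: "\<And>w. w \<in> space P \<Longrightarrow> continuous_on {0..} (\<lambda>t. X t w)"
    and A: "compact A" "A \<noteq> {}"
  shows "{w \<in> space P. limit_set (\<lambda>t. X t w) \<subseteq> A} \<in> sets P"
proof -
  define V where "V n = {y. norm y < real n \<and> inverse (real (Suc n)) < infdist y A}" for n :: nat
  have V: "open (V n)" for n
    unfolding V_def by (intro open_Collect_conj open_Collect_less continuous_intros)
  have "{w \<in> space P. \<exists>s\<in>{real N..} \<inter> \<rat>. X s w \<in> V n} \<in> sets P" for n N :: nat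
  proof -
    have "{w \<in> space P. \<exists>s\<in>{real N..} \<inter> \<rat>. X s w \<in> V n} = (\<Union>s\<in>{real N..} \<inter> \<rat>. X s -` V n \<inter> space P)"
      by auto
    also have "\<dots> \<in> sets P"
    proof (rule sets.countable_UN')
      show "countable ({real N..} \<inter> \<rat>)"
        using countable_rat by (rule countable_subset[rotated]) simp
      show "(\<lambda>s. X s -` V n \<inter> space P) ` ({real N..} \<inter> \<rat>) \<subseteq> sets P"
        by (auto intro!: measurable_sets[OF X] simp: V)
    qed
    finally show ?thesis .
  qed
  then have meas: "{w \<in> space P. \<forall>n. \<exists>N. \<not> (\<exists>s\<in>{real N..} \<inter> \<rat>. X s w \<in> V n)} \<in> sets P"
    by (simp only: sets.sets_Collect_countable_All sets.sets_Collect_countable_Ex sets.sets_Collect_neg)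
  have "{w \<in> space P. limit_set (\<lambda>t. X t w) \<subseteq> A} =
    {w \<in> space P. \<forall>n. \<exists>N. \<not> (\<exists>s\<in>{real N..} \<inter> \<rat>. X s w \<in> V n)}"
  proof (rule Collect_cong, rule conj_cong[OF refl])
    fix w assume "w \<in> space P"
    then have "(\<exists>s\<in>{real N..} \<inter> \<rat>. X s w \<in> V n) \<longleftrightarrow> (\<exists>s\<ge>real N. X s w \<in> V n)" for N n
      by (intro ex_visit_open_iff_rat[symmetric] cont V) auto
    then show "limit_set (\<lambda>t. X t w) \<subseteq> A \<longleftrightarrow> (\<forall>n. \<exists>N. \<not> (\<exists>s\<in>{real N..} \<inter> \<rat>. X s w \<in> V n))"
      unfolding limit_set_subset_iff[OF A] V_def[symmetric] by auto
  qed
  with meas show ?thesis by simp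
qed

section \<open>From conditional bounds to probabilities\<close>

text \<open>Integrating the conditional bound over \<open>H\<close> is all the conditioning that is
  used. For \<open>c < 1\<close> and \<open>H\<close> of positive probability it leaves a non-null
  part of \<open>H\<close> outside \<open>E\<close>.\<close>

lemma cond_prob_given_bound:
  assumes P: "prob_space P" and G: "subalgebra P G" and E: "E \<in> sets P" and H: "H \<in> sets G"
    and bd: "AE w in P. cond_prob_given P G E w \<le> c"
  shows "measure P (H \<inter> E) \<le> c * measure P H"
proof -
  interpret prob_space P by fact
  interpret finite_measure_subalgebra P G
    by unfold_locales fact
  have HP: "H \<in> sets P" using G H by (auto simp: subalgebra_def)
  have int: "integrable P (indicator E :: _ \<Rightarrow> real)"
    using E by (simp add: integrable_indicator_iff less_top[symmetric])
  have "measure P (H \<inter> E) = (\<integral>w\<in>H. indicator E w \<partial>P)"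
    using HP E by (simp add: set_lebesgue_integral_def indicator_inter_arith[symmetric])
  also have "\<dots> = (\<integral>w\<in>H. real_cond_exp P G (indicator E) w \<partial>P)"
    by (rule real_cond_exp_intA[OF int H])
  also have "\<dots> \<le> (\<integral>w\<in>H. c \<partial>P)"
    unfolding set_lebesgue_integral_def
  proof (rule integral_mono_AE)
    show "integrable P (\<lambda>w. indicator H w *\<^sub>R real_cond_exp P G (indicator E) w)"
      using real_cond_exp_int(1)[OF int] HP by (rule integrable_mult_indicator[rotated])
    show "integrable P (\<lambda>w. indicator H w *\<^sub>R c)"
      using HP by (intro integrable_mult_indicator) auto
    show "AE w in P. indicator H w *\<^sub>R real_cond_exp P G (indicator E) w \<le> indicator H w *\<^sub>R c"
      using bd by (rule eventually_mono) (auto simp: cond_prob_given_def indicator_def)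
  qed
  also have "\<dots> = c * measure P H"
    using HP by (simp add: set_lebesgue_integral_def)
  finally show ?thesis .
qed

section \<open>Shadowed paths and attractors\<close>

lemma solutions_iff: "z \<in> solutions F \<longleftrightarrow> is_solution F z"
  by (simp add: solutions_def solutions_from_def)

text \<open>What the failure of the event in the conditional bound says about a single path. The
  shadowing solution may change with \<open>s\<close>.\<close>

definition shadowed :: "('a::euclidean_space \<Rightarrow> 'a set) \<Rightarrow> real \<Rightarrow> real \<Rightarrow> real \<Rightarrow> (real \<Rightarrow> 'a) \<Rightarrow> bool" where
  "shadowed F t \<alpha> T x \<longleftrightarrow>
     (\<forall>s\<ge>t. \<exists>z. is_solution F z \<and> (\<forall>u\<in>{0..T}. norm (z u - x (s + u)) < \<alpha>))"

lemma shadowedD: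
  assumes "shadowed F t \<alpha> T x" "s \<ge> t"
  obtains z where "is_solution F z" "\<And>u. 0 \<le> u \<Longrightarrow> u \<le> T \<Longrightarrow> norm (z u - x (s + u)) < \<alpha>"
  using assms unfolding shadowed_def by (meson atLeastAtMost_iff)

lemma shadowedI_SUP_INF:
  assumes "\<not> (SUP s\<in>{t..}. INF z\<in>solutions F. unif_norm T (\<lambda>u. z u - x (s + u))) \<ge> ereal \<alpha>"
  shows "shadowed F t \<alpha> T x"
  unfolding shadowed_def
proof (intro allI impI)
  fix s assume s: "t \<le> s"
  have "(INF z\<in>solutions F. unif_norm T (\<lambda>u. z u - x (s + u)))
      \<le> (SUP s\<in>{t..}. INF z\<in>solutions F. unif_norm T (\<lambda>u. z u - x (s + u)))"
    using s by (intro SUP_upper) auto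
  also have "\<dots> < ereal \<alpha>" using assms by (simp add: not_le)
  finally obtain z where z: "z \<in> solutions F" "unif_norm T (\<lambda>u. z u - x (s + u)) < ereal \<alpha>"
    unfolding INF_less_iff by blast
  have "norm (z u - x (s + u)) < \<alpha>" if "u \<in> {0..T}" for u
  proof -
    have "ereal (norm (z u - x (s + u))) \<le> unif_norm T (\<lambda>u. z u - x (s + u))"
      unfolding unif_norm_def using that by (rule SUP_upper)
    also note z(2)
    finally show ?thesis by simp
  qed
  with z(1) show "\<exists>z. is_solution F z \<and> (\<forall>u\<in>{0..T}. norm (z u - x (s + u)) < \<alpha>)"
    by (auto simp: solutions_iff)
qed

lemma infdist_less_add:
  assumes "norm (a - b) < \<alpha>" "infdist a A < r"
  shows "infdist b A < r + \<alpha>"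
  using infdist_triangle[of b A a] assms by (simp add: dist_norm norm_minus_commute)

text \<open>From distance below \<open>r / 2\<close>, a shadowing solution starts within
  \<open>3 * r / 4\<close>, hence in \<open>U\<close>, and is within \<open>r / 4\<close> after
  \<open>T0\<close>; the path is then again below \<open>r / 2\<close>. The argument restarts with a
  fresh solution, and the window of times from \<open>T0\<close> to \<open>2 * T0\<close> lets the
  restarts reach every late \<open>v\<close>.\<close>

lemma shadowed_trapped:
  assumes U: "{y. infdist y A < r} \<subseteq> U" and r: "r > 0"
    and attr: "\<And>z t. is_solution F z \<Longrightarrow> z 0 \<in> U \<Longrightarrow> t \<ge> T0 \<Longrightarrow> infdist (z t) A < r / 4" and T0: "T0 > 0"
    and sh: "shadowed F t \<alpha> T x" and \<alpha>: "\<alpha> \<le> r / 4" and T: "2 * T0 \<le> T"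
    and s: "s \<ge> t" "infdist (x s) A < r / 2" and v: "v \<ge> s + T0"
  shows "infdist (x v) A < r / 2"
proof -
  have step: "infdist (x (s + u)) A < r / 2" if s: "s \<ge> t" "infdist (x s) A < r / 2" and u: "T0 \<le> u" "u \<le> 2 * T0" for s u
  proof -
    obtain z where z: "is_solution F z" "\<And>u. 0 \<le> u \<Longrightarrow> u \<le> T \<Longrightarrow> norm (z u - x (s + u)) < \<alpha>"
      using shadowedD[OF sh s(1)] by blast
    have "norm (x s - z 0) < \<alpha>"
      using z(2)[of 0] T T0 by (simp add: norm_minus_commute)
    then have "infdist (z 0) A < r / 2 + \<alpha>"
      by (rule infdist_less_add[OF _ s(2)])
    then have "z 0 \<in> U" using U \<alpha> r by auto
    then have "infdist (z u) A < r / 4" using u by (intro attr z(1)) auto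
    moreover have "norm (z u - x (s + u)) < \<alpha>" using u T T0 by (intro z(2)) auto
    ultimately have "infdist (x (s + u)) A < r / 4 + \<alpha>" by (intro infdist_less_add)
    then show ?thesis using \<alpha> by simp
  qed
  have iter: "infdist (x (s + real n * T0)) A < r / 2" for n
  proof (induction n)
    case 0
    then show ?case using s by simp
  next
    case (Suc n)
    have "t \<le> s + real n * T0" using s(1) T0 by (simp add: add_increasing2)
    from step[OF this Suc.IH, of T0] T0 show ?case by (simp add: algebra_simps)
  qed
  \<comment> \<open>One step fewer than the quotient allows: the remaining time must be at least
    \<open>T0\<close>, since nothing is known about the path sooner after a restart.\<close>
  define n where "n = nat \<lfloor>(v - s) / T0\<rfloor> - 1"
  have "1 \<le> (v - s) / T0" using v T0 by (simp add: le_divide_eq)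
  then have n: "real n + 1 \<le> (v - s) / T0" "(v - s) / T0 < real n + 2"
    unfolding n_def by linarith+
  then have "(real n + 1) * T0 \<le> v - s" "v - s < (real n + 2) * T0"
    using T0 by (simp_all add: le_divide_eq divide_less_eq)
  then have u: "T0 \<le> v - (s + real n * T0)" "v - (s + real n * T0) \<le> 2 * T0"
    by (simp_all add: algebra_simps)
  have "t \<le> s + real n * T0" using s(1) T0 by (simp add: add_increasing2)
  from step[OF this iter u] show ?thesis by simp
qed

text \<open>Being trapped at a fixed distance makes every late shadowing solution start in
  \<open>U\<close>. Closer shadowing over a longer horizon then brings the path within any
  \<open>e\<close> of \<open>A\<close>.\<close>

lemma limit_set_subset_attractor:
  assumes A: "compact A" "A \<noteq> {}" and U: "{y. infdist y A < r} \<subseteq> U" and r: "r > 0"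
    and attr: "\<And>e. e > 0 \<Longrightarrow> \<exists>T>0. \<forall>z t. is_solution F z \<longrightarrow> z 0 \<in> U \<longrightarrow> t \<ge> T \<longrightarrow> infdist (z t) A < e"
    and sh: "\<And>\<alpha> T. \<alpha> > 0 \<Longrightarrow> T > 0 \<Longrightarrow> \<exists>t. shadowed F t \<alpha> T x"
    and ev: "\<And>v. v \<ge> v0 \<Longrightarrow> infdist (x v) A < r / 2"
  shows "limit_set x \<subseteq> A"
proof -
  have ev': "\<exists>t. \<forall>s\<ge>t. infdist (x s) A < e" if e: "e > 0" for e
  proof -
    \<comment> \<open>The bound \<open>r / 2\<close> keeps the starting point of the solution in
      \<open>U\<close>; \<open>e / 2\<close> is spent once on attraction and once on
      shadowing.\<close>
    define e' where "e' = min (e / 2) (r / 2)"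
    have e': "e' > 0" using e r by (simp add: e'_def)
    obtain T where T: "T > 0" "\<And>z t. is_solution F z \<Longrightarrow> z 0 \<in> U \<Longrightarrow> t \<ge> T \<Longrightarrow> infdist (z t) A < e'"
      using attr[OF e'] by blast
    obtain t where t: "shadowed F t e' T x"
      using sh[OF e' T(1)] by blast
    have "infdist (x s) A < e" if s: "s \<ge> max t v0 + T" for s
    proof -
      have "s - T \<ge> t" using s by simp
      then obtain z where z: "is_solution F z" "\<And>u. 0 \<le> u \<Longrightarrow> u \<le> T \<Longrightarrow> norm (z u - x (s - T + u)) < e'"
        using shadowedD[OF t] by blast
      have "norm (x (s - T) - z 0) < e'"
        using z(2)[of 0] T(1) by (simp add: norm_minus_commute)
      moreover have "infdist (x (s - T)) A < r / 2" using s by (intro ev) auto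
      ultimately have "infdist (z 0) A < r / 2 + e'" by (rule infdist_less_add)
      then have "z 0 \<in> U" using U by (auto simp: e'_def)
      then have "infdist (z T) A < e'" by (intro T(2) z(1)) auto
      moreover have "norm (z T - x s) < e'" using z(2)[of T] T(1) by simp
      ultimately have "infdist (x s) A < e' + e'" by (intro infdist_less_add)
      then show ?thesis by (simp add: e'_def)
    qed
    then show ?thesis by blast
  qed
  show ?thesis
    unfolding limit_set_subset_iff[OF A]
  proof
    fix n :: nat
    obtain t where t: "\<And>s. s \<ge> t \<Longrightarrow> infdist (x s) A < inverse (real (Suc n))"
      using ev'[of "inverse (real (Suc n))"] by auto
    obtain N :: nat where "t \<le> real N"
      using real_arch_simple by blast
    then have "infdist (x s) A < inverse (real (Suc n))" if "s \<ge> real N" for s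
      using that by (intro t) simp
    then have "x s \<notin> {y. norm y < real n \<and> inverse (real (Suc n)) < infdist y A}" if "s \<ge> real N" for s
      using that by (auto dest: less_asym)
    then show "\<exists>N. \<forall>s\<ge>real N. x s \<notin> {y. norm y < real n \<and> inverse (real (Suc n)) < infdist y A}"
      by blast
  qed
qed

text \<open>Compactness of \<open>A\<close> gives a tube of uniform radius inside the neighbourhood
  of attraction, and flow images are unfolded into statements on single solutions.\<close>

lemma attractorD:
  assumes "attractor F A"
  obtains U r where "r > 0" "{y. infdist y A < r} \<subseteq> U"
    "\<forall>e>0. \<exists>T>0. \<forall>z t. is_solution F z \<longrightarrow> z 0 \<in> U \<longrightarrow> t \<ge> T \<longrightarrow> infdist (z t) A < e"
proof -
  obtain U where U: "A \<subseteq> interior U"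
    "\<And>e. e > 0 \<Longrightarrow> \<exists>T>0. \<forall>t\<ge>T. (\<Union>x\<in>U. flow F t x) \<subseteq> {y. infdist y A < e}"
    and A: "compact A" "A \<noteq> {}"
    using assms unfolding attractor_def by blast
  obtain r where r: "r > 0" "(\<Union>x\<in>A. ball x r) \<subseteq> interior U"
    using compact_subset_open_imp_ball_epsilon_subset[OF A(1) open_interior U(1)] by blast
  have sub: "{y. infdist y A < r} \<subseteq> U"
  proof
    fix y assume y: "y \<in> {y. infdist y A < r}"
    obtain a where "a \<in> A" "infdist y A = dist y a"
      using infdist_attains_inf[OF compact_imp_closed[OF A(1)] A(2)] by blast
    with y have "y \<in> ball a r" "a \<in> A" by (auto simp: dist_commute)
    with r(2) interior_subset show "y \<in> U" by blast
  qed
  show thesis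
  proof (rule that[OF r(1) sub], intro allI impI)
    fix e :: real assume "e > 0"
    then obtain T where T: "T > 0" "\<And>t. t \<ge> T \<Longrightarrow> (\<Union>x\<in>U. flow F t x) \<subseteq> {y. infdist y A < e}"
      using U(2) by blast
    have "infdist (z t) A < e" if "is_solution F z" "z 0 \<in> U" "t \<ge> T" for z t
    proof -
      have "z t \<in> flow F t (z 0)"
        using that(1) by (auto simp: flow_def solutions_from_def)
      then show ?thesis using T(2)[OF that(3)] that(2) by blast
    qed
    with T(1) show "\<exists>T>0. \<forall>z t. is_solution F z \<longrightarrow> z 0 \<in> U \<longrightarrow> t \<ge> T \<longrightarrow> infdist (z t) A < e"
      by blast
  qed
qed

lemma shadowed_mono:
  assumes "shadowed F t \<alpha> T x" "\<alpha> \<le> \<beta>" "T' \<le> T"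
  shows "shadowed F t \<beta> T' x"
  using assms unfolding shadowed_def by (meson atLeastAtMost_iff less_le_trans order_trans)

text \<open>Conditioning at a deterministic time avoids stopping times: since the paths are continuous, an
  open set visited with positive probability is visited with positive probability at some fixed
  rational time.\<close>

lemma visit_open_at_rational_time:
  fixes X :: "real \<Rightarrow> 'w \<Rightarrow> 'a::euclidean_space"
  assumes P: "prob_space P"
    and X: "\<And>t. t \<ge> 0 \<Longrightarrow> X t \<in> borel_measurable P"
    and cont: "\<And>w. w \<in> space P \<Longrightarrow> continuous_on {0..} (\<lambda>t. X t w)"
    and U: "open U" and t: "t \<ge> 0" and pos: "measure P {w \<in> space P. \<exists>s\<ge>t. X s w \<in> U} > 0"
  obtains s where "s \<ge> t" "measure P (X s -` U \<inter> space P) > 0"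
proof -
  interpret prob_space P by fact
  have eq: "{w \<in> space P. \<exists>s\<ge>t. X s w \<in> U} = (\<Union>s\<in>{t..} \<inter> \<rat>. X s -` U \<inter> space P)"
    using ex_visit_open_iff_rat[OF cont U t] by auto
  have sets: "X s -` U \<inter> space P \<in> sets P" if "s \<in> {t..} \<inter> \<rat>" for s
    using X[of s] that t U by (intro measurable_sets[of _ _ borel]) auto
  have cnt: "countable ({t..} \<inter> \<rat>)"
    using countable_rat by (rule countable_subset[rotated]) simp
  have "\<exists>s\<in>{t..} \<inter> \<rat>. measure P (X s -` U \<inter> space P) > 0"
  proof (rule ccontr)
    assume "\<not> ?thesis"
    then have "measure P (X s -` U \<inter> space P) = 0" if "s \<in> {t..} \<inter> \<rat>" for s
      using that by (simp add: zero_less_measure_iff)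
    then have "X s -` U \<inter> space P \<in> null_sets P" if "s \<in> {t..} \<inter> \<rat>" for s
      using sets[OF that] that by (auto simp: null_sets_def emeasure_eq_measure)
    then have "(\<Union>s\<in>{t..} \<inter> \<rat>. X s -` U \<inter> space P) \<in> null_sets P"
      by (rule null_sets_UN'[OF cnt])
    with pos show False by (simp add: eq null_sets_def measure_def)
  qed
  then show thesis using that by auto
qed

section \<open>Convergence to the attractor with positive probability\<close>

theorem theorem2p8:
  fixes F :: "real ^ 'm \<Rightarrow> (real ^ 'm) set"
    and M A :: "(real ^ 'm) set"
    and P :: "'w measure"
    and Fil :: "real \<Rightarrow> 'w measure"
    and X :: "real \<Rightarrow> 'w \<Rightarrow> real ^ 'm"
    and om :: "real \<Rightarrow> real \<Rightarrow> real \<Rightarrow> real"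
  assumes "standard_map F"
    and "compact M"
    and "attractor F A"
    and "prob_space P"
    and "nonneg_filtration P Fil"
    and "\<And>t. t \<ge> 0 \<Longrightarrow> X t \<in> borel_measurable (Fil t)"
    and "\<And>w. w \<in> space P \<Longrightarrow> continuous_on {0..} (\<lambda>t. X t w)"
    and "\<And>t \<alpha> T. t \<ge> 0 \<Longrightarrow> \<alpha> \<ge> 0 \<Longrightarrow> T \<ge> 0 \<Longrightarrow> om t \<alpha> T \<ge> 0"
    and "\<And>\<alpha> T. \<alpha> > 0 \<Longrightarrow> T > 0 \<Longrightarrow> antimono_on {0..} (\<lambda>t. om t \<alpha> T)"
    and "\<And>\<alpha> T. \<alpha> > 0 \<Longrightarrow> T > 0 \<Longrightarrow> ((\<lambda>t. om t \<alpha> T) \<longlongrightarrow> 0) at_top"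
    and "\<And>t \<alpha> T. t \<ge> 0 \<Longrightarrow> \<alpha> > 0 \<Longrightarrow> T > 0 \<Longrightarrow>
           AE w in P. cond_prob_given P (Fil t)
             {w'\<in>space P. (SUP s\<in>{t..}. INF z\<in>solutions F. unif_norm T (\<lambda>u. z u - X (s + u) w'))
                 \<ge> ereal \<alpha>} w \<le> om t \<alpha> T"
    and "attainable P M X \<inter> basin F A \<noteq> {}"
  shows "measure P {w\<in>space P. limit_set (\<lambda>t. X t w) \<subseteq> A} > 0"
proof -
  interpret prob_space P by fact
  note F = assms(1) and om0 = assms(10)
  note cont = assms(7)
  have sub: "subalgebra P (Fil t)" if "t \<ge> 0" for t
    using assms(5) that by (simp add: nonneg_filtration_def)
  have X: "X t \<in> borel_measurable P" if "t \<ge> 0" for t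
    by (rule measurable_from_subalg[OF sub[OF that] assms(6)[OF that]])
  have A: "compact A" "A \<noteq> {}"
    using assms(3) by (auto simp: attractor_def)
  define E where "E t \<alpha> T = {w'\<in>space P. (SUP s\<in>{t..}. INF z\<in>solutions F. unif_norm T (\<lambda>u. z u - X (s + u) w'))
                 \<ge> ereal \<alpha>}" for t \<alpha> T
  have Esets: "E t \<alpha> T \<in> sets P" if t: "t \<ge> 0" for t \<alpha> T
  proof -
    have [measurable]: "(\<lambda>w. SUP s\<in>{t..}. INF z\<in>solutions F. unif_norm T (\<lambda>u. z u - X (s + u) w)) \<in> borel_measurable P"
      by (intro measurable_SUP_INF_unif_norm X cont t) (auto simp: solutions_iff is_solutionD(2))
    show ?thesis unfolding E_def by measurable
  qed
  have notE: "shadowed F t \<alpha> T (\<lambda>t. X t w)" if "w \<in> space P" "w \<notin> E t \<alpha> T" for t \<alpha> T w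
    using that by (intro shadowedI_SUP_INF) (auto simp: E_def)
  have bound: "prob (H \<inter> E t \<alpha> T) \<le> om t \<alpha> T * prob H"
    if "t \<ge> 0" "\<alpha> > 0" "T > 0" "H \<in> sets (Fil t)" for t \<alpha> T H
    by (rule cond_prob_given_bound[OF assms(4) sub[OF that(1)] Esets[OF that(1)] that(4)
          assms(11)[OF that(1-3), folded E_def]])
  \<comment> \<open>A path that is shadowed from no integer time lies in every
    \<open>E (real n) \<alpha> T\<close>, and the probabilities of these events are bounded by
    \<open>om (real n) \<alpha> T\<close>, which tends to 0.\<close>
  have "AE w in P. \<exists>t. shadowed F t \<alpha> T (\<lambda>t. X t w)" if \<alpha>: "\<alpha> > 0" and T: "T > 0" for \<alpha> T
  proof -
    have N: "(\<Inter>n. E (real n) \<alpha> T) \<in> sets P"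
      by (intro sets.countable_INT) (auto simp: Esets)
    have "prob (\<Inter>n. E (real n) \<alpha> T) \<le> 0"
    proof (rule LIMSEQ_le_const)
      show "(\<lambda>n. om (real n) \<alpha> T) \<longlonglongrightarrow> 0"
        using om0[OF \<alpha> T] filterlim_real_sequentially by (rule filterlim_compose)
      have "prob (\<Inter>n. E (real n) \<alpha> T) \<le> om (real n) \<alpha> T" for n
      proof -
        have "space P \<in> sets (Fil (real n))"
          using sub[of "real n"] by (metis of_nat_0_le_iff sets.top subalgebra_def)
        from bound[OF _ \<alpha> T this] have "prob (space P \<inter> E (real n) \<alpha> T) \<le> om (real n) \<alpha> T"
          by (simp add: prob_space)
        moreover have "prob (\<Inter>n. E (real n) \<alpha> T) \<le> prob (space P \<inter> E (real n) \<alpha> T)"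
          by (intro finite_measure_mono) (auto simp: E_def Esets[unfolded E_def])
        ultimately show ?thesis by simp
      qed
      then show "\<exists>N. \<forall>n\<ge>N. prob (\<Inter>n. E (real n) \<alpha> T) \<le> om (real n) \<alpha> T" by blast
    qed
    then have "prob (\<Inter>n. E (real n) \<alpha> T) = 0"
      by (simp add: measure_le_0_iff)
    then have "(\<Inter>n. E (real n) \<alpha> T) \<in> null_sets P"
      using N by (simp add: null_sets_def emeasure_eq_measure)
    then have "AE w in P. w \<notin> (\<Inter>n. E (real n) \<alpha> T)"
      by (rule AE_not_in)
    then show ?thesis
      by (rule AE_mp) (use notE in \<open>blast intro: AE_I2\<close>)
  qed
  \<comment> \<open>Shadowing is monotone in accuracy and horizon, so a sequence of pairs covers all
    \<open>(\<alpha>, T)\<close> and a single null set suffices.\<close>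
  then have "AE w in P. \<forall>k. \<exists>t. shadowed F t (inverse (real (Suc k))) (real (Suc k)) (\<lambda>t. X t w)"
    unfolding AE_all_countable by simp
  then have apt: "AE w in P. \<forall>\<alpha> T. \<alpha> > 0 \<longrightarrow> T > 0 \<longrightarrow> (\<exists>t. shadowed F t \<alpha> T (\<lambda>t. X t w))"
  proof (rule eventually_mono, intro allI impI)
    fix w and \<alpha> T :: real
    assume sh: "\<forall>k. \<exists>t. shadowed F t (inverse (real (Suc k))) (real (Suc k)) (\<lambda>t. X t w)" and "\<alpha> > 0" "T > 0"
    obtain k :: nat where k: "max (inverse \<alpha>) T \<le> real k"
      using real_arch_simple by blast
    then have "inverse \<alpha> \<le> real (Suc k)" "T \<le> real (Suc k)" by auto
    then have "inverse (real (Suc k)) \<le> \<alpha>" "T \<le> real (Suc k)"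
      using le_imp_inverse_le[of "inverse \<alpha>" "real (Suc k)"] \<open>\<alpha> > 0\<close> by auto
    then show "\<exists>t. shadowed F t \<alpha> T (\<lambda>t. X t w)"
      using sh shadowed_mono by blast
  qed
  obtain U r where r: "r > 0" and U: "{y. infdist y A < r} \<subseteq> U"
    and attr: "\<forall>e>0. \<exists>T>0. \<forall>z t. is_solution F z \<longrightarrow> z 0 \<in> U \<longrightarrow> t \<ge> T \<longrightarrow> infdist (z t) A < e"
    using attractorD[OF assms(3)] by metis
  have r4: "r / 4 > 0" using r by simp
  obtain T0 where T0: "T0 > 0" "\<And>z t. is_solution F z \<Longrightarrow> z 0 \<in> U \<Longrightarrow> t \<ge> T0 \<Longrightarrow> infdist (z t) A < r / 4"
    using attr[rule_format, OF r4] by blast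
  obtain p where p: "p \<in> attainable P M X" "p \<in> basin F A"
    using assms(12) by blast
  obtain T1 d where T1: "T1 > 0" and d: "d > 0"
    and reach: "\<And>z. is_solution F z \<Longrightarrow> norm (z 0 - p) < d \<Longrightarrow> infdist (z T1) A < r / 4"
    using basin_reaches_neighborhood_uniformly[OF F p(2) r4] by blast
  \<comment> \<open>With \<open>X\<close> within \<open>d / 2\<close> of \<open>p\<close>, accuracy
    \<open>d / 2\<close> puts the solution within \<open>d\<close> of \<open>p\<close>, and
    \<open>r / 4\<close> is what the trap allows. The horizon \<open>T\<close> covers both the entry
    time \<open>T1\<close> and the window \<open>2 * T0\<close> of the trap.\<close>
  define \<alpha> where "\<alpha> = min (d / 2) (r / 4)"
  define T where "T = max T1 (2 * T0)"
  have \<alpha>: "\<alpha> > 0" and T: "T > 0" using r d T1 by (auto simp: \<alpha>_def T_def)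
  obtain t where t: "t > 0" "\<And>s. s \<ge> t \<Longrightarrow> om s \<alpha> T < 1"
    using order_tendstoD(2)[OF om0[OF \<alpha> T], of 1] unfolding eventually_at_top_linorder
    by (metis max.bounded_iff max.strict_coboundedI2 zero_less_one)
  have "\<forall>t>0. \<forall>U. open U \<and> p \<in> U \<longrightarrow> prob {w \<in> space P. \<exists>s\<ge>t. X s w \<in> U} > 0"
    using p(1) by (simp add: attainable_def)
  moreover have "open (ball p (d / 2)) \<and> p \<in> ball p (d / 2)" using d by simp
  ultimately have visit: "prob {w \<in> space P. \<exists>s\<ge>t. X s w \<in> ball p (d / 2)} > 0"
    using t(1) by blast
  obtain s where s: "s \<ge> t" "prob (X s -` ball p (d / 2) \<inter> space P) > 0"
    using visit_open_at_rational_time[OF assms(4) X cont open_ball less_imp_le[OF t(1)] visit] by blast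
  define H where "H = X s -` ball p (d / 2) \<inter> space P"
  have s0: "s \<ge> 0" using s t by simp
  have HFil: "H \<in> sets (Fil s)"
    using measurable_sets[OF assms(6)[OF s0], of "ball p (d / 2)"] sub[OF s0] by (simp add: H_def subalgebra_def)
  then have H: "H \<in> sets P" using sub[OF s0] by (auto simp: subalgebra_def)
  \<comment> \<open>The event \<open>H\<close> is known at time \<open>s\<close>, so the factor
    below 1 acts on \<open>H\<close> alone and a non-null part of the visiting paths is shadowed
    from \<open>s\<close> on.\<close>
  have "prob (H \<inter> E s \<alpha> T) \<le> om s \<alpha> T * prob H"
    by (rule bound[OF s0 \<alpha> T HFil])
  also have "\<dots> < prob H"
    using t(2)[OF s(1)] s(2) by (simp add: H_def)
  finally have "prob (H - E s \<alpha> T) > 0"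
    using finite_measure_Diff'[OF H Esets[OF s0], of \<alpha> T] by simp
  also have "prob (H - E s \<alpha> T) \<le> prob {w \<in> space P. limit_set (\<lambda>t. X t w) \<subseteq> A}"
  proof (rule finite_measure_mono_AE)
    show "{w \<in> space P. limit_set (\<lambda>t. X t w) \<subseteq> A} \<in> sets P"
      by (rule sets_limit_set_subset[OF X cont A])
    show "AE w in P. w \<in> H - E s \<alpha> T \<longrightarrow> w \<in> {w \<in> space P. limit_set (\<lambda>t. X t w) \<subseteq> A}"
      using apt
    proof (rule eventually_mono, intro impI)
      fix w assume apt: "\<forall>\<alpha> T. \<alpha> > 0 \<longrightarrow> T > 0 \<longrightarrow> (\<exists>t. shadowed F t \<alpha> T (\<lambda>t. X t w))" and w: "w \<in> H - E s \<alpha> T"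
      then have wP: "w \<in> space P" and Xs: "dist p (X s w) < d / 2" by (auto simp: H_def)
      have sh: "shadowed F s \<alpha> T (\<lambda>t. X t w)" using w wP by (intro notE) auto
      obtain z where z: "is_solution F z" "\<And>u. 0 \<le> u \<Longrightarrow> u \<le> T \<Longrightarrow> norm (z u - X (s + u) w) < \<alpha>"
        using shadowedD[OF sh order_refl] by blast
      have "norm (z 0 - p) \<le> norm (z 0 - X s w) + norm (X s w - p)"
        by (rule norm_diff_triangle_le[OF order_refl order_refl])
      also have "\<dots> < d"
        using z(2)[of 0] T Xs by (simp add: \<alpha>_def dist_norm norm_minus_commute)
      finally have "infdist (z T1) A < r / 4" by (rule reach[OF z(1)])
      moreover have "norm (z T1 - X (s + T1) w) < \<alpha>"
        using T1 by (intro z(2)) (auto simp: T_def)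
      ultimately have "infdist (X (s + T1) w) A < r / 4 + \<alpha>" by (intro infdist_less_add)
      then have near: "infdist (X (s + T1) w) A < r / 2" by (simp add: \<alpha>_def)
      \<comment> \<open>The path enters the trap at time \<open>s + T1\<close>; shadowing from
        \<open>s\<close> on includes all later restarts.\<close>
      have "infdist (X v w) A < r / 2" if "v \<ge> s + T1 + T0" for v
      proof (rule shadowed_trapped[where x = "\<lambda>t. X t w" and s = "s + T1", OF U r _ T0(1) sh])
        show "infdist (z t) A < r / 4" if "is_solution F z" "z 0 \<in> U" "T0 \<le> t" for z t
          using that by (rule T0(2))
        show "\<alpha> \<le> r / 4" "2 * T0 \<le> T" "s \<le> s + T1"
          using T1 by (auto simp: \<alpha>_def T_def)
      qed (use near that in auto)
      then have "limit_set (\<lambda>t. X t w) \<subseteq> A"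
        using apt by (intro limit_set_subset_attractor[where x = "\<lambda>t. X t w", OF A U r attr[rule_format]]) auto
      with wP show "w \<in> {w \<in> space P. limit_set (\<lambda>t. X t w) \<subseteq> A}" by simp
    qed
  qed
  finally show ?thesis .
qed

end
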